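(* Every finite metric space $X$ of strictly negative type admits a microscopic weighting and therefore has the one-point property, $\lim_{t\to0}\mu_X(t)=1$. The microscopic weighting is given by $$\lim_{t\to0}\mathbf{w}(t)=\operatorname{con}(D)\,D^{-1}\mathbf{1},$$ where $D$ is the distance matrix of $X$. In particular, these statements hold for every finite subset of Euclidean space, every finite subset of hyperbolic space, and every finite tree.
   Context: Let $X=\{x_1,\dots,x_n\}$ be a finite metric space with metric $d$. Its distance matrix is $D=(d(x_i,x_j))_{i,j}$. For $t>0$, its similarity matrix at scale $t$ is $Z(t)=(e^{-t d(x_i,x_j)})_{i,j}$. Write $\mathbf{1}=(1,\dots,1)^{\mathrm T}\in\mathbb{R}^n$. For all sufficiently small $t>0$, $Z(t)$ is invertible; put $\mathbf{w}(t)=Z(t)^{-1}\mathbf{1}$ and $\mu_X(t)=\mathbf{1}^{\mathrm T}\mathbf{w}(t)$ (the magnitude of $X$ at scale $t$). $X$ admits a microscopic weighting if $\lim_{t\to0}\mathbf{w}(t)$ (as $t$ decreases to $0$) exists componentwise in $\mathbb{R}^n$; the limit is then the microscopic weighting on $X$. $X$ is of strictly negative type if $\mathbf{u}^{\mathrm T}D\mathbf{u}<0$ for every nonzero $\mathbf{u}\in\mathbb{R}^n$ with $\mathbf{1}^{\mathrm T}\mathbf{u}=0$. A gauging for a symmetric real $n\times n$ matrix $A$ is a vector $\mathbf{v}\in\mathbb{R}^n$ with $\mathbf{1}^{\mathrm T}\mathbf{v}=1$ and $A\mathbf{v}=c\mathbf{1}$ for some $c\in\mathbb{R}$. All gaugings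 of $A$ have the same $c$; the concentration $\operatorname{con}(A)\in\mathbb{R}\cup\{\infty\}$ is this $c$ if a gauging exists, and $\infty$ otherwise. *)

theory Defs
  imports
    "HOL-Analysis.Analysis"
    "Graph_Theory.Digraph_Component"
    "Graph_Theory.Shortest_Path"
begin

text \<open>
  A finite metric space \<open>X = {x\<^sub>1, \<dots>, x\<^sub>n}\<close> with metric \<open>d\<close> is given by its set of points \<open>X\<close> and an
  enumeration \<open>x :: 'n \<Rightarrow> 'a\<close> of it, i.e. \<open>bij_betw x UNIV X\<close>, by a finite index type \<open>'n\<close> (so \<open>X\<close> is
  finite and nonempty). In \<open>real^'n\<close> the all-ones vector is \<open>1\<close>, and \<open>1 \<bullet> v\<close> is the sum of the
  entries of \<open>v\<close>.
\<close>

definition distance_matrix :: "('a \<Rightarrow> 'a \<Rightarrow> real) \<Rightarrow> ('n::finite \<Rightarrow> 'a) \<Rightarrow> real^'n^'n" where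
  "distance_matrix d x = (\<chi> i j. d (x i) (x j))"

definition similarity_matrix ::
    "('a \<Rightarrow> 'a \<Rightarrow> real) \<Rightarrow> ('n::finite \<Rightarrow> 'a) \<Rightarrow> real \<Rightarrow> real^'n^'n" where
  "similarity_matrix d x t = (\<chi> i j. exp (- t * d (x i) (x j)))"

text \<open>
  \<open>weighting_at\<close> and \<open>magnitude_at\<close> are meaningful only at scales where the similarity matrix is
  invertible.
\<close>

definition weighting_at :: "('a \<Rightarrow> 'a \<Rightarrow> real) \<Rightarrow> ('n::finite \<Rightarrow> 'a) \<Rightarrow> real \<Rightarrow> real^'n" where
  "weighting_at d x t = matrix_inv (similarity_matrix d x t) *v 1"

definition magnitude_at :: "('a \<Rightarrow> 'a \<Rightarrow> real) \<Rightarrow> ('n::finite \<Rightarrow> 'a) \<Rightarrow> real \<Rightarrow> real" where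
  "magnitude_at d x t = 1 \<bullet> weighting_at d x t"

text \<open>
  The similarity matrix of a finite metric space is invertible at all sufficiently small scales.
  The next definitions demand this explicitly, so that the limits never refer to the unspecified
  value of \<open>matrix_inv\<close> at a singular matrix.
\<close>

definition is_microscopic_weighting ::
    "('a \<Rightarrow> 'a \<Rightarrow> real) \<Rightarrow> ('n::finite \<Rightarrow> 'a) \<Rightarrow> real^'n \<Rightarrow> bool" where
  "is_microscopic_weighting d x v \<longleftrightarrow>
     (\<forall>\<^sub>F t in at_right 0. invertible (similarity_matrix d x t)) \<and>
     (weighting_at d x \<longlongrightarrow> v) (at_right 0)"

definition admits_microscopic_weighting ::
    "('a \<Rightarrow> 'a \<Rightarrow> real) \<Rightarrow> ('n::finite \<Rightarrow> 'a) \<Rightarrow> bool" where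
  "admits_microscopic_weighting d x \<longleftrightarrow> (\<exists>v. is_microscopic_weighting d x v)"

definition one_point_property :: "('a \<Rightarrow> 'a \<Rightarrow> real) \<Rightarrow> ('n::finite \<Rightarrow> 'a) \<Rightarrow> bool" where
  "one_point_property d x \<longleftrightarrow>
     (\<forall>\<^sub>F t in at_right 0. invertible (similarity_matrix d x t)) \<and>
     (magnitude_at d x \<longlongrightarrow> 1) (at_right 0)"

definition strictly_negative_type :: "('a \<Rightarrow> 'a \<Rightarrow> real) \<Rightarrow> ('n::finite \<Rightarrow> 'a) \<Rightarrow> bool" where
  "strictly_negative_type d x \<longleftrightarrow>
     (\<forall>u::real^'n. u \<noteq> 0 \<and> 1 \<bullet> u = 0 \<longrightarrow> u \<bullet> (distance_matrix d x *v u) < 0)"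

definition gauging :: "real^'n^'n \<Rightarrow> real^'n \<Rightarrow> real \<Rightarrow> bool" where
  "gauging A v c \<longleftrightarrow> 1 \<bullet> v = 1 \<and> A *v v = c *\<^sub>R 1"

definition con :: "real^'n^'n \<Rightarrow> ereal" where
  "con A = (if \<exists>v c. gauging A v c then ereal (THE c. \<exists>v. gauging A v c) else \<infinity>)"

lemma gauging_unique:
  fixes A :: "real^'n^'n"
  assumes "transpose A = A" "gauging A v c" "gauging A v' c'"
  shows "c = c'"
proof -
  have "c = v' \<bullet> (A *v v)"
    using assms by (simp add: gauging_def inner_commute)
  also have "\<dots> = (A *v v') \<bullet> v"
    using assms(1) by (metis dot_lmul_matrix vector_transpose_matrix)
  also have "\<dots> = c'"
    using assms by (simp add: gauging_def)
  finally show ?thesis .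
qed

lemma con_eq:
  assumes "transpose A = A" "gauging A v c"
  shows "con A = ereal c"
proof -
  have "(THE c. \<exists>v. gauging A v c) = c"
    using assms gauging_unique by (blast intro: the_equality)
  then show ?thesis
    using assms(2) by (auto simp: con_def)
qed

text \<open>
  Hyperbolic space of dimension \<open>DIM('a)\<close> and curvature \<open>-1\<close>, as the upper sheet of the hyperboloid
  \<open>s\<^sup>2 - p \<bullet> p = 1\<close> in Minkowski space \<open>\<real> \<times> 'a\<close>.
\<close>

definition hyperbolic_space :: "(real \<times> 'a::euclidean_space) set" where
  "hyperbolic_space = {(s, p). s > 0 \<and> s\<^sup>2 - p \<bullet> p = 1}"

definition hyperbolic_dist :: "real \<times> 'a::euclidean_space \<Rightarrow> real \<times> 'a \<Rightarrow> real" where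
  "hyperbolic_dist x y = arcosh (fst x * fst y - snd x \<bullet> snd y)"

text \<open>
  The locale \<open>graph\<close> provides finite simple undirected graphs, each edge being a pair of opposite
  arcs. The library predicate \<open>tree\<close> cannot be used for them: traversing an edge back and forth
  counts there as a cycle. Cycles of an undirected graph are the directed ones of length at least 3.
\<close>

definition finite_tree :: "('v, 'b) pre_digraph \<Rightarrow> bool" where
  "finite_tree G \<longleftrightarrow>
     graph G \<and> Digraph_Component.connected G \<and>
     \<not> (\<exists>p. pre_digraph.cycle G p \<and> length p \<ge> 3)"

text \<open>Positive edge lengths; \<open>l = (\<lambda>_. 1)\<close> gives unweighted graphs.\<close>

definition edge_lengths :: "('v, 'b) pre_digraph \<Rightarrow> ('b \<Rightarrow> real) \<Rightarrow> bool" where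
  "edge_lengths G l \<longleftrightarrow>
     (\<forall>e \<in> arcs G. l e > 0) \<and>
     (\<forall>e \<in> arcs G. \<forall>e' \<in> arcs G.
        tail G e = head G e' \<and> head G e = tail G e' \<longrightarrow> l e = l e')"

definition path_dist :: "('v, 'b) pre_digraph \<Rightarrow> ('b \<Rightarrow> real) \<Rightarrow> 'v \<Rightarrow> 'v \<Rightarrow> real" where
  "path_dist G l u v = real_of_ereal (wf_digraph.\<mu> G l u v)"

end

theory Submission
  imports Defs "HOL-Real_Asymp.Real_Asymp"
begin

text \<open>
  Write \<open>J\<close> for the all-ones matrix and \<open>Z(t) = J - t M(t)\<close>, where \<open>M(t)\<close> tends to the distance
  matrix \<open>D\<close>. Strictly negative type makes \<open>D\<close> invertible with \<open>1 \<bullet> D\<inverse> 1 \<noteq> 0\<close>, so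
  \<open>v(t) = M(t)\<inverse> 1\<close> tends to \<open>D\<inverse> 1\<close>, and \<open>Z(t) v(t) = (1 \<bullet> v(t) - t) 1\<close> shows that the weighting is
  \<open>v(t) / (1 \<bullet> v(t) - t)\<close>.

  Euclidean and hyperbolic distances are of strictly negative type because \<open>- ln (1 - k\<^sub>i \<bullet> k\<^sub>j)\<close>,
  a power series with nonnegative coefficients in the Gram kernel of points of the open unit ball, is strictly
  positive definite. In hyperbolic space this makes \<open>ln (cosh d)\<close> strictly conditionally negative, and
  \<open>d\<close> is the limit of \<open>ln (cosh (2\<^sup>m d)) / 2\<^sup>m\<close>, each doubling step adding only a conditionally
  negative kernel. In Euclidean space \<open>ln (1 + (dist x y)\<^sup>2 / s\<^sup>2)\<close> is of the same logarithmic form for every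
  \<open>s > 0\<close>, and its integral over \<open>s\<close> is \<open>pi * dist x y\<close>. Adding a leaf at distance \<open>c\<close> with weight \<open>a\<close> to a tree
  and moving its weight to the neighbour changes the quadratic form by \<open>- 2 c a\<^sup>2\<close>.
\<close>

section \<open>Spaces of strictly negative type\<close>

lemma one_inner_vec: "(1::real^'n) \<bullet> u = (\<Sum>i\<in>UNIV. u $ i)"
  by (simp add: inner_vec_def)

lemma symmetric_inner_mult_vec:
  fixes A :: "real^'n^'n"
  assumes "transpose A = A"
  shows "u \<bullet> (A *v v) = v \<bullet> (A *v u)"
  by (metis assms dot_lmul_matrix inner_commute vector_transpose_matrix)

lemma invertible_iff_ker_zero:
  fixes A :: "real^'n^'n"
  shows "invertible A \<longleftrightarrow> (\<forall>v. A *v v = 0 \<longrightarrow> v = 0)"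
  using invertible_left_inverse matrix_left_invertible_ker by blast

lemma matrix_inv_mult:
  fixes A :: "real^'n^'n"
  assumes "invertible A"
  shows "A ** matrix_inv A = mat 1" "matrix_inv A ** A = mat 1"
  using someI_ex[OF assms[unfolded invertible_def]] by (auto simp: matrix_inv_def)

lemma matrix_inv_mult_vec_eqI:
  fixes A :: "real^'n^'n"
  assumes "invertible A" "A *v v = w"
  shows "matrix_inv A *v w = v"
  using assms by (metis matrix_inv_mult(2) matrix_vector_mul_assoc matrix_vector_mul_lid)

lemma mult_matrix_inv_vec:
  fixes A :: "real^'n^'n"
  assumes "invertible A"
  shows "A *v (matrix_inv A *v w) = w"
  using assms by (simp add: matrix_vector_mul_assoc matrix_inv_mult)

text \<open>By Cramer's rule each entry of the solution is a quotient of determinants, which are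
  polynomials in the matrix entries. The limit of the denominators is nonzero, which also gives
  invertibility near the limit.\<close>

lemma tendsto_matrix_inv_mult_vec:
  fixes A :: "'b \<Rightarrow> real^'n^'n"
  assumes lim: "\<And>i j. ((\<lambda>t. A t $ i $ j) \<longlongrightarrow> L $ i $ j) F" and inv: "invertible L"
  shows "\<forall>\<^sub>F t in F. invertible (A t)"
    and "((\<lambda>t. matrix_inv (A t) *v b) \<longlongrightarrow> matrix_inv L *v b) F"
proof -
  have det: "((\<lambda>t. det (M t)) \<longlongrightarrow> det N) F"
    if "\<And>i j. ((\<lambda>t. M t $ i $ j) \<longlongrightarrow> N $ i $ j) F" for M :: "'b \<Rightarrow> real^'n^'n" and N
    unfolding det_def by (intro tendsto_intros that)
  have "\<forall>\<^sub>F t in F. det (A t) \<noteq> 0"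
    using det[OF lim] inv by (simp add: invertible_det_nz tendsto_imp_eventually_ne)
  then show ev: "\<forall>\<^sub>F t in F. invertible (A t)"
    by (simp add: invertible_det_nz)
  define c where "c M = (\<chi> k. det (\<chi> i j. if j = k then b $ i else M $ i $ j) / det M)"
    for M :: "real^'n^'n"
  have c: "matrix_inv M *v b = c M" if "invertible M" for M
    using that cramer[of M "matrix_inv M *v b" b]
    by (simp add: c_def invertible_det_nz mult_matrix_inv_vec)
  have "((\<lambda>t. c (A t)) \<longlongrightarrow> c L) F"
    unfolding c_def using inv
    by (intro tendsto_intros det lim) (auto simp: invertible_det_nz intro: lim)
  then show "((\<lambda>t. matrix_inv (A t) *v b) \<longlongrightarrow> matrix_inv L *v b) F"
    unfolding c[OF inv] by (rule Lim_transform_eventually) (use ev in \<open>auto elim!: eventually_mono simp: c\<close>)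
qed

text \<open>The conditions concern only points enumerated by \<open>x\<close>, because
  \<open>hyperbolic_dist\<close> and \<open>path_dist\<close> are meaningful distances only on part
  of their types.\<close>

locale strictly_negative_type_matrix =
  fixes d :: "'a \<Rightarrow> 'a \<Rightarrow> real" and x :: "'n::finite \<Rightarrow> 'a"
  assumes sym: "d (x i) (x j) = d (x j) (x i)"
    and diag: "d (x i) (x i) = 0"
    and neg: "strictly_negative_type d x"
begin

abbreviation "D \<equiv> distance_matrix d x"
abbreviation "Z \<equiv> similarity_matrix d x"

lemma transpose_D: "transpose D = D"
  by (simp add: transpose_def distance_matrix_def vec_eq_iff sym)

lemma negative: "1 \<bullet> u = 0 \<Longrightarrow> u \<noteq> 0 \<Longrightarrow> u \<bullet> (D *v u) < 0"
  using neg by (auto simp: strictly_negative_type_def)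

lemma inner_D_axis: "axis i a \<bullet> (D *v axis j b) = a * b * d (x i) (x j)"
proof -
  have "D *v axis j b = (\<chi> i. b * d (x i) (x j))"
    by (simp add: distance_matrix_def matrix_vector_mult_def vec_eq_iff axis_def if_distrib
        mult.commute cong: if_cong)
  then show ?thesis
    by (simp add: inner_axis')
qed

text \<open>The form takes the value \<open>- 2 * d (x i) (x j)\<close> at the difference of two
  unit vectors.\<close>

lemma positive_off_diagonal:
  assumes "i \<noteq> j"
  shows "d (x i) (x j) > 0"
proof -
  have "axis i 1 - axis j (1::real) \<noteq> 0"
    using assms by (auto simp: axis_def vec_eq_iff)
  moreover have "1 \<bullet> (axis i 1 - axis j (1::real)) = 0"
    by (simp add: inner_diff_right inner_axis)
  ultimately have "(axis i 1 - axis j 1) \<bullet> (D *v (axis i 1 - axis j 1)) < 0"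
    by (rule negative[rotated])
  then show ?thesis
    by (simp add: inner_diff_left inner_diff_right matrix_vector_mult_diff_distrib inner_D_axis diag
        sym[of j i])
qed

text \<open>A nonzero kernel vector cannot have sum zero. If its sum is nonzero, a multiple of it
  moves \<open>axis i 1 + axis j 1\<close> into the hyperplane of sum zero without changing the
  form, whose value \<open>2 * d (x i) (x j)\<close> there has the wrong sign.\<close>

lemma invertible_D:
  assumes "CARD('n) \<ge> 2"
  shows "invertible D"
  unfolding invertible_iff_ker_zero
proof (intro allI impI)
  fix v assume v: "D *v v = 0"
  show "v = 0"
  proof (cases "1 \<bullet> v = 0")
    case True
    then show ?thesis using negative[of v] v by auto
  next
    case False
    obtain i j :: 'n where "i \<noteq> j"
      using assms by (metis card_2_iff' obtain_subset_with_card_n)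
    define u where "u = axis i 1 + axis j (1::real)"
    define w where "w = u - (1 \<bullet> u / (1 \<bullet> v)) *\<^sub>R v"
    have "D *v w = D *v u"
      by (simp add: w_def matrix_vector_mult_diff_distrib matrix_vector_mult_scaleR v)
    moreover have "v \<bullet> (D *v u) = 0"
      using symmetric_inner_mult_vec[OF transpose_D, of v u] v by simp
    ultimately have "w \<bullet> (D *v w) = u \<bullet> (D *v u)"
      by (simp add: w_def inner_diff_left)
    also have "\<dots> = 2 * d (x i) (x j)"
      by (simp add: u_def inner_add_left inner_add_right matrix_vector_right_distrib inner_D_axis diag
        sym[of j i])
    also have "\<dots> > 0"
      using positive_off_diagonal[OF \<open>i \<noteq> j\<close>] by simp
    finally have "w \<bullet> (D *v w) > 0" .
    moreover have "1 \<bullet> w = 0"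
      using False by (simp add: w_def inner_diff_right)
    ultimately show ?thesis
      using negative[of w] by (cases "w = 0") auto
  qed
qed

text \<open>For \<open>v = matrix_inv D *v 1\<close> the form at \<open>v\<close> equals
  \<open>1 \<bullet> v\<close>. If this were zero, strict negativity would force
  \<open>v = 0\<close>, against \<open>D *v v = 1\<close>.\<close>

lemma one_inner_D_inv:
  assumes "CARD('n) \<ge> 2"
  shows "1 \<bullet> (matrix_inv D *v 1) \<noteq> 0"
proof
  assume *: "1 \<bullet> (matrix_inv D *v 1) = 0"
  have D: "D *v (matrix_inv D *v 1) = 1"
    by (rule mult_matrix_inv_vec[OF invertible_D[OF assms]])
  with * have "matrix_inv D *v 1 = 0"
    using negative[of "matrix_inv D *v 1"] by (auto simp: inner_commute)
  with D show False
    by (simp add: vec_eq_iff)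
qed

lemma con_D:
  assumes "CARD('n) \<ge> 2"
  shows "con D = ereal (1 / (1 \<bullet> (matrix_inv D *v 1)))"
proof (rule con_eq[OF transpose_D])
  let ?v = "matrix_inv D *v 1"
  show "gauging D ((1 / (1 \<bullet> ?v)) *\<^sub>R ?v) (1 / (1 \<bullet> ?v))"
    using one_inner_D_inv[OF assms] mult_matrix_inv_vec[OF invertible_D[OF assms]]
    by (simp add: gauging_def matrix_vector_mult_scaleR)
qed

section \<open>The weighting at small scales and its limit\<close>

definition M :: "real \<Rightarrow> real^'n^'n" where
  "M t = (\<chi> i j. (1 - exp (- t * d (x i) (x j))) / t)"

lemma Z_mult_vec: "t \<noteq> 0 \<Longrightarrow> Z t *v u = (1 \<bullet> u) *\<^sub>R 1 - t *\<^sub>R (M t *v u)"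
  by (simp add: vec_eq_iff matrix_vector_mult_def similarity_matrix_def M_def one_inner_vec
      sum_distrib_left flip: sum_subtractf) (simp add: algebra_simps)

lemma M_tendsto: "((\<lambda>t. M t $ i $ j) \<longlongrightarrow> D $ i $ j) (at_right 0)"
proof -
  have "((\<lambda>t. (1 - exp (- t * d (x i) (x j)))) has_real_derivative d (x i) (x j)) (at 0)"
    by (auto intro!: derivative_eq_intros)
  then have "((\<lambda>t. (1 - exp (- t * d (x i) (x j))) / t) \<longlongrightarrow> d (x i) (x j)) (at 0)"
    by (simp add: DERIV_def)
  then show ?thesis
    unfolding M_def distance_matrix_def by (simp add: filterlim_at_split)
qed

lemma eventually_weighting:
  assumes "CARD('n) \<ge> 2"
  shows "\<forall>\<^sub>F t in at_right 0. invertible (Z t) \<and>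
    weighting_at d x t = (1 / (1 \<bullet> (matrix_inv (M t) *v 1) - t)) *\<^sub>R (matrix_inv (M t) *v 1)"
proof -
  let ?v = "\<lambda>t. matrix_inv (M t) *v 1"
  note lim = tendsto_matrix_inv_mult_vec[OF M_tendsto invertible_D[OF assms]]
  have "((\<lambda>t. 1 \<bullet> ?v t - t) \<longlongrightarrow> 1 \<bullet> (matrix_inv D *v 1) - 0) (at_right 0)"
    by (intro tendsto_intros lim)
  then have "\<forall>\<^sub>F t in at_right 0. 1 \<bullet> ?v t - t \<noteq> 0"
    using one_inner_D_inv[OF assms] by (intro tendsto_imp_eventually_ne) auto
  with lim(1) eventually_at_right_less[of 0] show ?thesis
  proof eventually_elim
    case (elim t)
    let ?s = "1 \<bullet> ?v t"
    have Mv: "M t *v ?v t = 1"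
      by (rule mult_matrix_inv_vec[OF elim(1)])
    have inv: "invertible (Z t)"
      \<comment> \<open>A kernel vector of \<open>Z t\<close> is a multiple of \<open>?v t\<close>.
        Comparing sums of entries gives \<open>(1 \<bullet> u) * (?s - t) = 0\<close>, so the
        multiple is zero.\<close>
      unfolding invertible_iff_ker_zero
    proof (intro allI impI)
      fix u assume "Z t *v u = 0"
      then have "M t *v u = ((1 \<bullet> u) / t) *\<^sub>R 1"
        using elim(2) by (simp add: Z_mult_vec vec_eq_iff field_simps)
      then have u: "u = ((1 \<bullet> u) / t) *\<^sub>R ?v t"
        using matrix_inv_mult_vec_eqI[OF elim(1)] by (metis matrix_vector_mult_scaleR)
      then have "1 \<bullet> u = (1 \<bullet> u) / t * ?s"
        by (metis inner_scaleR_right)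
      then have "(1 \<bullet> u) * (?s - t) = 0"
        using elim(2) by (auto simp: field_simps)
      then have "1 \<bullet> u = 0"
        using elim(3) by auto
      with u show "u = 0"
        by simp
    qed
    have "Z t *v ((1 / (?s - t)) *\<^sub>R ?v t) = ((1 / (?s - t)) * (?s - t)) *\<^sub>R 1"
      using elim(2) by (simp add: Z_mult_vec matrix_vector_mult_scaleR Mv flip: scaleR_diff_left diff_divide_distrib)
    then have "Z t *v ((1 / (?s - t)) *\<^sub>R ?v t) = 1"
      using elim(3) by simp
    then show ?case
      using inv matrix_inv_mult_vec_eqI[OF inv] unfolding weighting_at_def by blast
  qed
qed

lemma is_microscopic_weighting_con:
  assumes "CARD('n) \<ge> 2"
  shows "is_microscopic_weighting d x (real_of_ereal (con D) *\<^sub>R (matrix_inv D *v 1))"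
  unfolding is_microscopic_weighting_def
proof
  note ev = eventually_weighting[OF assms]
  show "\<forall>\<^sub>F t in at_right 0. invertible (Z t)"
    using ev by (rule eventually_mono) auto
  note lim = tendsto_matrix_inv_mult_vec(2)[OF M_tendsto invertible_D[OF assms], where b = 1]
  have "((\<lambda>t. (1 / (1 \<bullet> (matrix_inv (M t) *v 1) - t)) *\<^sub>R (matrix_inv (M t) *v 1)) \<longlongrightarrow>
      (1 / (1 \<bullet> (matrix_inv D *v 1) - 0)) *\<^sub>R (matrix_inv D *v 1)) (at_right 0)"
    using one_inner_D_inv[OF assms] by (intro tendsto_intros lim) auto
  then show "(weighting_at d x \<longlongrightarrow> real_of_ereal (con D) *\<^sub>R (matrix_inv D *v 1)) (at_right 0)"
    unfolding con_D[OF assms] 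
    by (rule Lim_transform_eventually[THEN tendsto_eq_rhs])
       (use ev in \<open>auto elim!: eventually_mono\<close>)
qed

lemma microscopic_weighting_point:
  assumes "CARD('n) < 2"
  shows "is_microscopic_weighting d x 1" "1 \<bullet> (1::real^'n) = (1::real)"
proof -
  have "CARD('n) = 1"
    using assms zero_less_card_finite[where 'a = 'n] by linarith
  then obtain a :: 'n where UNIV: "UNIV = {a}"
    using card_1_singletonE by blast
  then have all: "(\<forall>i. P i) \<longleftrightarrow> P a" for P
    by (metis UNIV_I singletonD)
  show "1 \<bullet> (1::real^'n) = (1::real)"
    unfolding one_inner_vec UNIV by simp
  have Z: "Z t = mat 1" for t
    by (simp add: vec_eq_iff similarity_matrix_def mat_def all diag)
  have "matrix_inv (mat 1) *v 1 = (1::real^'n)"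
    by (rule matrix_inv_mult_vec_eqI) (auto simp: invertible_iff_ker_zero)
  then show "is_microscopic_weighting d x 1"
    unfolding is_microscopic_weighting_def Z weighting_at_def
    by (auto simp: Z invertible_iff_ker_zero)
qed

lemma microscopic_weighting_and_one_point_property:
  "admits_microscopic_weighting d x \<and> one_point_property d x \<and>
    (CARD('n) \<ge> 2 \<longrightarrow> invertible D \<and> con D \<noteq> \<infinity> \<and>
      is_microscopic_weighting d x (real_of_ereal (con D) *\<^sub>R (matrix_inv D *v 1)))"
proof -
  \<comment> \<open>The magnitude is the sum of the entries of the weighting, so it tends to the sum
    of the entries of the limit.\<close>
  have *: "admits_microscopic_weighting d x \<and> one_point_property d x"
    if "is_microscopic_weighting d x v" "1 \<bullet> v = 1" for v
    using that tendsto_inner[OF tendsto_const, of "weighting_at d x" v "at_right 0" 1]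
    by (auto simp: admits_microscopic_weighting_def one_point_property_def
        is_microscopic_weighting_def magnitude_at_def[abs_def])
  show ?thesis
  proof (cases "CARD('n) \<ge> 2")
    case True
    have "1 \<bullet> (real_of_ereal (con D) *\<^sub>R (matrix_inv D *v 1)) = 1"
      using one_inner_D_inv[OF True] by (simp add: con_D[OF True])
    then show ?thesis
      using *[OF is_microscopic_weighting_con[OF True]] is_microscopic_weighting_con[OF True]
        invertible_D[OF True] con_D[OF True] by simp
  next
    case False
    then show ?thesis
      using * microscopic_weighting_point by auto
  qed
qed

end

section \<open>Positive definite kernels\<close>

text \<open>Any finite index type is allowed, so that \<open>'i option\<close> can serve to adjoin
  one more point.\<close>

definition quad_form :: "('i::finite \<Rightarrow> real) \<Rightarrow> ('i \<Rightarrow> 'i \<Rightarrow> real) \<Rightarrow> real" where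
  "quad_form u K = (\<Sum>i\<in>UNIV. \<Sum>j\<in>UNIV. u i * u j * K i j)"

lemma quad_form_add: "quad_form u (\<lambda>i j. K i j + L i j) = quad_form u K + quad_form u L"
  by (simp add: quad_form_def algebra_simps sum.distrib)

lemma quad_form_diff: "quad_form u (\<lambda>i j. K i j - L i j) = quad_form u K - quad_form u L"
  by (simp add: quad_form_def algebra_simps sum_subtractf)

lemma quad_form_cmult: "quad_form u (\<lambda>i j. c * K i j) = c * quad_form u K"
  by (simp add: quad_form_def algebra_simps sum_distrib_left)

lemma quad_form_uminus: "quad_form u (\<lambda>i j. - K i j) = - quad_form u K"
  using quad_form_cmult[of u "-1" K] by simp

lemma quad_form_rank1: "quad_form u (\<lambda>i j. f i * f j) = (\<Sum>i\<in>UNIV. u i * f i)\<^sup>2"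
  by (simp add: quad_form_def power2_eq_square sum_product algebra_simps)

text \<open>Each part factors through the vanishing sum of \<open>u\<close>. This discards rescaling
  terms such as \<open>ln (S i) + ln (S j)\<close>.\<close>

lemma quad_form_separate:
  assumes "(\<Sum>i\<in>UNIV. u i) = 0"
  shows "quad_form u (\<lambda>i j. f i + g j) = 0"
proof -
  have "quad_form u (\<lambda>i j. f i + g j) =
      (\<Sum>i\<in>UNIV. u i * f i) * (\<Sum>j\<in>UNIV. u j) + (\<Sum>i\<in>UNIV. u i) * (\<Sum>j\<in>UNIV. u j * g j)"
    unfolding quad_form_def sum_product sum.distrib[symmetric]
    by (intro sum.cong) (simp_all add: algebra_simps)
  then show ?thesis by (simp add: assms)
qed

lemma quad_form_const: "(\<Sum>i\<in>UNIV. u i) = 0 \<Longrightarrow> quad_form u (\<lambda>i j. c) = 0"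
  using quad_form_separate[of u "\<lambda>_. c" "\<lambda>_. 0"] by simp

lemma tendsto_quad_form:
  assumes "\<And>i j. ((\<lambda>t. K t i j) \<longlongrightarrow> L i j) F"
  shows "((\<lambda>t. quad_form u (K t)) \<longlongrightarrow> quad_form u L) F"
  unfolding quad_form_def by (intro tendsto_intros assms)

lemma quad_form_sums:
  assumes "\<And>i j. (\<lambda>m. K m i j) sums L i j"
  shows "(\<lambda>m. quad_form u (K m)) sums quad_form u L"
  unfolding quad_form_def by (intro sums_sum sums_mult assms)

text \<open>
  Positive definite kernels are introduced as the closed cone generated by the kernels of rank one, so that
  closure under pointwise products is a rule induction and needs no decomposition of matrices.
\<close>

inductive pd_kernel :: "('i \<Rightarrow> 'i \<Rightarrow> real) \<Rightarrow> bool" where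
  rank1: "pd_kernel (\<lambda>i j. f i * f j)"
| add: "pd_kernel K \<Longrightarrow> pd_kernel L \<Longrightarrow> pd_kernel (\<lambda>i j. K i j + L i j)"
| lim: "(\<And>m. pd_kernel (K m)) \<Longrightarrow> (\<And>i j. (\<lambda>m. K m i j) \<longlonglongrightarrow> L i j) \<Longrightarrow> pd_kernel L"

lemma quad_form_nonneg: "pd_kernel K \<Longrightarrow> quad_form u K \<ge> 0"
proof (induction rule: pd_kernel.induct)
  case (lim K L)
  then show ?case
    using LIMSEQ_le_const[OF tendsto_quad_form[of K L sequentially u]] by blast
qed (simp_all add: quad_form_rank1 quad_form_add)

lemma pd_kernel_rank1_mult: "pd_kernel L \<Longrightarrow> pd_kernel (\<lambda>i j. f i * f j * L i j)"
proof (induction rule: pd_kernel.induct)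
  case (rank1 g)
  then show ?case
    using pd_kernel.rank1[of "\<lambda>i. f i * g i"] by (simp add: mult_ac)
next
  case (add K L)
  then show ?case
    using pd_kernel.add[of "\<lambda>i j. f i * f j * K i j" "\<lambda>i j. f i * f j * L i j"] by (simp add: distrib_left)
next
  case (lim K L)
  show ?case
    by (rule pd_kernel.lim[of "\<lambda>m i j. f i * f j * K m i j", OF lim.IH]) (intro tendsto_intros lim)
qed

text \<open>Schur product theorem: induction on the left factor, with the rank-one case settled by
  induction on the right one.\<close>

lemma pd_kernel_mult: "pd_kernel K \<Longrightarrow> pd_kernel L \<Longrightarrow> pd_kernel (\<lambda>i j. K i j * L i j)"
proof (induction rule: pd_kernel.induct)
  case (rank1 f)
  then show ?case by (rule pd_kernel_rank1_mult)
next
  case (add K K')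
  then show ?case
    using pd_kernel.add[of "\<lambda>i j. K i j * L i j" "\<lambda>i j. K' i j * L i j"] by (simp add: distrib_right)
next
  case (lim K M)
  show ?case
    by (rule pd_kernel.lim[of "\<lambda>m i j. K m i j * L i j", OF lim.IH[OF lim.prems]]) (intro tendsto_intros lim)
qed

lemma pd_kernel_const: "c \<ge> 0 \<Longrightarrow> pd_kernel (\<lambda>i j. c)"
  using pd_kernel.rank1[of "\<lambda>_. sqrt c"] by simp

lemma pd_kernel_cmult: "c \<ge> 0 \<Longrightarrow> pd_kernel K \<Longrightarrow> pd_kernel (\<lambda>i j. c * K i j)"
  by (rule pd_kernel_mult[OF pd_kernel_const])

lemma pd_kernel_sum:
  assumes "\<And>m. m \<in> A \<Longrightarrow> pd_kernel (K m)"
  shows "pd_kernel (\<lambda>i j. \<Sum>m\<in>A. K m i j)"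
  using assms
proof (induction A rule: infinite_finite_induct)
  case (insert m A)
  then show ?case
    using pd_kernel.add[of "K m" "\<lambda>i j. \<Sum>m\<in>A. K m i j"] by simp
qed (simp_all add: pd_kernel_const)

lemma pd_kernel_sums:
  assumes "\<And>m. pd_kernel (K m)" and "\<And>i j. (\<lambda>m. K m i j) sums L i j"
  shows "pd_kernel L"
  by (rule pd_kernel.lim[of "\<lambda>n i j. \<Sum>m<n. K m i j", OF pd_kernel_sum])
    (use assms in \<open>auto simp: sums_def\<close>)

lemma pd_kernel_power: "pd_kernel K \<Longrightarrow> pd_kernel (\<lambda>i j. K i j ^ m)"
proof (induction m)
  case (Suc m)
  then show ?case
    using pd_kernel_mult[of K "\<lambda>i j. K i j ^ m"] by simp
qed (simp add: pd_kernel_const)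

lemma pd_kernel_inner: "pd_kernel (\<lambda>i j. p i \<bullet> (p j :: 'e::euclidean_space))"
proof -
  have "pd_kernel (\<lambda>i j. \<Sum>b\<in>Basis. (p i \<bullet> b) * (p j \<bullet> b))"
    by (rule pd_kernel_sum) (rule pd_kernel.rank1)
  then show ?thesis
    by (simp only: euclidean_inner[symmetric])
qed

lemma pd_kernel_geometric:
  assumes "pd_kernel K" "\<And>i j. \<bar>K i j\<bar> < 1"
  shows "pd_kernel (\<lambda>i j. 1 / (1 - K i j))"
  by (rule pd_kernel_sums[OF pd_kernel_power[OF assms(1)]]) (use assms in \<open>auto intro: geometric_sums\<close>)

text \<open>The term of index 0 vanishes because \<open>1 / real 0 = 0\<close>, so the series really
  starts with \<open>y\<close>.\<close>

lemma ln_one_minus_sums: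
  assumes "\<bar>y::real\<bar> < 1"
  shows "(\<lambda>m. 1 / real m * y ^ m) sums - ln (1 - y)"
  using sums_minus[OF ln_series'[of "- y"]] assms by simp

lemma pd_kernel_ln:
  assumes "pd_kernel K" "\<And>i j. \<bar>K i j\<bar> < 1"
  shows "pd_kernel (\<lambda>i j. - ln (1 - K i j))"
proof (rule pd_kernel_sums)
  show "pd_kernel (\<lambda>i j. 1 / real m * K i j ^ m)" for m
    by (rule pd_kernel_cmult[OF _ pd_kernel_power[OF assms(1)]]) simp
  show "(\<lambda>m. 1 / real m * K i j ^ m) sums - ln (1 - K i j)" for i j
    by (rule ln_one_minus_sums[OF assms(2)])
qed

section \<open>Strictness of the logarithmic kernel\<close>

text \<open>A Vandermonde argument: vanishing moments annihilate every polynomial, in particular the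
  one whose roots are all nodes except \<open>c i\<close>.\<close>

lemma power_sums_eq_zero_imp:
  fixes c :: "'i::finite \<Rightarrow> real"
  assumes "inj c" and zero: "\<And>m. (\<Sum>i\<in>UNIV. u i * c i ^ m) = 0"
  shows "u i = 0"
proof -
  define p where "p = (\<Prod>j\<in>UNIV - {i}. [:- c j, 1:])"
  have p: "poly p (c j) = (\<Prod>k\<in>UNIV - {i}. c j - c k)" for j
    by (simp add: p_def poly_prod)
  have "(\<Sum>j\<in>UNIV. u j * poly p (c j)) = (\<Sum>m\<le>degree p. coeff p m * (\<Sum>j\<in>UNIV. u j * c j ^ m))"
    by (simp add: poly_altdef sum_distrib_left mult_ac sum.swap[of _ _ "UNIV::'i set"])
  also have "\<dots> = 0"
    by (simp add: zero)
  also have "(\<Sum>j\<in>UNIV. u j * poly p (c j)) = (\<Sum>j\<in>{i}. u j * poly p (c j))"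
    by (rule sum.mono_neutral_right) (auto simp: p)
  finally have "u i * poly p (c i) = 0"
    by simp
  moreover have "poly p (c i) \<noteq> 0"
    using \<open>inj c\<close> by (auto simp: p dest: injD)
  ultimately show ?thesis
    by simp
qed

text \<open>The bad directions lie in finitely many hyperplanes orthogonal to the differences
  \<open>k i - k j\<close>; these are negligible and cannot cover the space.\<close>

lemma exists_separating_direction:
  fixes k :: "'i::finite \<Rightarrow> 'e::euclidean_space"
  assumes "inj k"
  shows "\<exists>z. inj (\<lambda>i. k i \<bullet> z)"
proof -
  let ?W = "(\<lambda>(i, j). {z. (k i - k j) \<bullet> z = 0}) ` {(i, j). i \<noteq> j}"
  have "negligible (\<Union>?W)"
    using assms by (intro negligible_Union) (auto intro!: negligible_hyperplane dest: injD)
  then obtain z where "z \<notin> \<Union>?W"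
    using non_negligible_UNIV by (metis UNIV_eq_I)
  then show ?thesis
    by (intro exI[of _ z] injI) (auto simp: inner_diff_left)
qed

text \<open>
  Adjoining the point \<open>z\<close> with weight \<open>e\<close> keeps the form nonnegative, so its part linear in \<open>e\<close>
  must vanish.
\<close>

lemma quad_form_inner_power_eq_zero_imp:
  fixes k :: "'i::finite \<Rightarrow> 'e::euclidean_space"
  assumes "quad_form u (\<lambda>i j. (k i \<bullet> k j) ^ m) = 0"
  shows "(\<Sum>i\<in>UNIV. u i * (k i \<bullet> z) ^ m) = 0"
proof -
  define L c where "L = (\<Sum>i\<in>UNIV. u i * (k i \<bullet> z) ^ m)" and "c = (z \<bullet> z) ^ m"
  define k' where "k' = case_option z k"
  have c: "c \<ge> 0"
    by (simp add: c_def)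
  \<comment> \<open>This weight turns \<open>e\<^sup>2 * c + 2 * e * L\<close> into
    \<open>- (e\<^sup>2 * (c + 2))\<close>. The denominator is \<open>c + 1\<close> because
    \<open>c\<close> may be zero.\<close>
  define e where "e = - L / (c + 1)"
  with c have L: "L = - e * (c + 1)"
    by (simp add: field_simps)
  have "0 \<le> quad_form (case_option e u) (\<lambda>i j. (k' i \<bullet> k' j) ^ m)"
    by (intro quad_form_nonneg pd_kernel_power pd_kernel_inner)
  also have "\<dots> = e\<^sup>2 * c + 2 * e * L + quad_form u (\<lambda>i j. (k i \<bullet> k j) ^ m)"
    by (simp add: quad_form_def UNIV_option_conv sum.reindex k'_def L_def c_def power2_eq_square
        sum.distrib sum_distrib_left inner_commute algebra_simps)
  also have "\<dots> = - (e\<^sup>2 * (c + 2))"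
    unfolding assms L by (simp add: algebra_simps power2_eq_square)
  finally have "e = 0"
    using c by (simp add: mult_le_0_iff)
  then show ?thesis
    using L by (simp add: L_def)
qed

text \<open>The negated form is a series of nonnegative terms \<open>q m / m\<close>. If every
  relevant \<open>q m\<close> vanished, so would all moments of \<open>u\<close> along a separating
  direction, and hence \<open>u\<close>.\<close>

lemma quad_form_ln_one_minus_inner_neg:
  fixes k :: "'i::finite \<Rightarrow> 'e::euclidean_space"
  assumes "inj k" and norm: "\<And>i. norm (k i) < 1"
    and sum: "(\<Sum>i\<in>UNIV. u i) = 0" and u: "u i0 \<noteq> 0"
  shows "quad_form u (\<lambda>i j. ln (1 - k i \<bullet> k j)) < 0"
proof -
  have less1: "\<bar>k i \<bullet> k j\<bar> < 1" for i j
    using Cauchy_Schwarz_ineq2[of "k i" "k j"] mult_strict_mono[OF norm norm, of j i] by auto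
  define q where "q m = quad_form u (\<lambda>i j. (k i \<bullet> k j) ^ m)" for m
  have q0: "q m \<ge> 0" for m
    unfolding q_def by (intro quad_form_nonneg pd_kernel_power pd_kernel_inner)
  have sums: "(\<lambda>m. 1 / real m * q m) sums - quad_form u (\<lambda>i j. ln (1 - k i \<bullet> k j))"
    using quad_form_sums[OF ln_one_minus_sums[OF less1], of u]
    by (simp only: quad_form_cmult quad_form_uminus q_def)
  obtain z where z: "inj (\<lambda>i. k i \<bullet> z)"
    using exists_separating_direction[OF \<open>inj k\<close>] by blast
  obtain m where m: "(\<Sum>i\<in>UNIV. u i * (k i \<bullet> z) ^ m) \<noteq> 0"
    using power_sums_eq_zero_imp[OF z] u by blast
  \<comment> \<open>Index 0 must be excluded, as its coefficient \<open>1 / real 0\<close> is zero;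
    its moment is the sum of \<open>u\<close>.\<close>
  then have "m \<noteq> 0"
    using sum by (intro notI) simp
  moreover have "q m > 0"
    using quad_form_inner_power_eq_zero_imp[of u k m z] m q0[of m] by (force simp: q_def)
  ultimately have "0 < (\<Sum>m. 1 / real m * q m)"
    using sums q0 by (intro suminf_pos2[of _ m]) (auto simp: sums_iff)
  then show ?thesis
    using sums by (simp add: sums_iff)
qed

section \<open>Hyperbolic and Euclidean distances\<close>

text \<open>
  A family of timelike vectors \<open>(S i, p i)\<close> of Minkowski space, no two of them proportional.
\<close>

locale timelike_family =
  fixes S :: "'i::finite \<Rightarrow> real" and p :: "'i \<Rightarrow> 'e::euclidean_space"
  assumes norm_less: "norm (p i) < S i"
    and inj: "inj (\<lambda>i. p i /\<^sub>R S i)"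
begin

text \<open>The Minkowski product of the vectors with indices \<open>i\<close> and
  \<open>j\<close>.\<close>

definition B :: "'i \<Rightarrow> 'i \<Rightarrow> real" where
  "B i j = S i * S j - p i \<bullet> p j"

lemma pos: "S i > 0"
  using norm_less[of i] norm_ge_zero[of "p i"] by linarith

lemma norm_less1: "norm (p i /\<^sub>R S i) < 1"
  using pos[of i] norm_less[of i] by (simp add: field_simps)

lemma inner_less1: "\<bar>(p i /\<^sub>R S i) \<bullet> (p j /\<^sub>R S j)\<bar> < 1"
  using Cauchy_Schwarz_ineq2[of "p i /\<^sub>R S i" "p j /\<^sub>R S j"]
    mult_strict_mono[OF norm_less1[of i] norm_less1[of j]] by auto

text \<open>Projection to the open unit ball, as in the Beltrami-Klein model, separates a rank-one
  factor from a kernel built on the Gram kernel of the ball.\<close>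

lemma B_eq: "B i j = S i * S j * (1 - (p i /\<^sub>R S i) \<bullet> (p j /\<^sub>R S j))"
  using pos[of i] pos[of j] by (simp add: B_def field_simps)

lemma pd_kernel_inverse_B: "pd_kernel (\<lambda>i j. 1 / B i j)"
proof -
  have "pd_kernel (\<lambda>i j. 1 / S i * (1 / S j) * (1 / (1 - (p i /\<^sub>R S i) \<bullet> (p j /\<^sub>R S j))))"
    by (intro pd_kernel_mult pd_kernel.rank1 pd_kernel_geometric pd_kernel_inner inner_less1)
  then show ?thesis
    by (simp add: B_eq[abs_def])
qed

lemma quad_form_ln_B_neg:
  assumes "(\<Sum>i\<in>UNIV. u i) = 0" "u i0 \<noteq> 0"
  shows "quad_form u (\<lambda>i j. ln (B i j)) < 0"
proof -
  have "ln (B i j) = (ln (S i) + ln (S j)) + ln (1 - (p i /\<^sub>R S i) \<bullet> (p j /\<^sub>R S j))" for i j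
    unfolding B_eq using pos[of i] pos[of j] inner_less1[of i j]
    by (subst ln_mult; simp add: ln_mult)
  then have "quad_form u (\<lambda>i j. ln (B i j)) =
      quad_form u (\<lambda>i j. ln (1 - (p i /\<^sub>R S i) \<bullet> (p j /\<^sub>R S j)))"
    by (simp only: quad_form_add[of u "\<lambda>i j. ln (S i) + ln (S j)"] quad_form_separate[OF assms(1)] add_0)
  then show ?thesis
    using quad_form_ln_one_minus_inner_neg[OF inj norm_less1 assms] by simp
qed

end

section \<open>The doubling argument for \<open>ln (cosh d)\<close>\<close>

lemma inverse_cosh_power2_le_1: "(1 / cosh (x::real))\<^sup>2 \<le> 1"
  using cosh_real_ge_1[of x] by (intro power_le_one) simp_all

text \<open>
  \<open>cosh (2 * x) = 2 * (cosh x)\<^sup>2 - 1\<close> turns \<open>1 / cosh (2 * x)\<close> into a geometric series in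
  \<open>1 / (cosh x)\<^sup>2\<close>, and \<open>ln (cosh (2 * x)) - 2 * ln (cosh x)\<close> into a logarithmic one.
\<close>

lemma pd_kernel_inverse_cosh_double:
  assumes "pd_kernel (\<lambda>i j. 1 / cosh (d i j))"
  shows "pd_kernel (\<lambda>i j. 1 / cosh (2 * d i j))"
    and "pd_kernel (\<lambda>i j. - ln (1 - 1 / 2 * (1 / cosh (d i j))\<^sup>2))"
proof -
  have pd: "pd_kernel (\<lambda>i j. 1 / 2 * (1 / cosh (d i j))\<^sup>2)"
    by (intro pd_kernel_cmult pd_kernel_power assms) simp
  have less1: "\<bar>1 / 2 * (1 / cosh x)\<^sup>2\<bar> < 1" for x :: real
    using inverse_cosh_power2_le_1[of x] zero_le_power2[of "1 / cosh x"] by linarith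
  have "1 / 2 * (1 / cosh x)\<^sup>2 * (1 / (1 - 1 / 2 * (1 / cosh x)\<^sup>2)) = 1 / cosh (2 * x)" for x :: real
    using cosh_real_pos[of x] less1[of x] cosh_real_pos[of "2 * x"]
    by (simp add: cosh_double_cosh power_divide divide_simps)
  then show "pd_kernel (\<lambda>i j. 1 / cosh (2 * d i j))"
    using pd_kernel_mult[OF pd pd_kernel_geometric[OF pd less1]] by simp
  show "pd_kernel (\<lambda>i j. - ln (1 - 1 / 2 * (1 / cosh (d i j))\<^sup>2))"
    by (rule pd_kernel_ln[OF pd less1])
qed

text \<open>In \<open>ln (cosh (2 * x)) = ln 2 + 2 * ln (cosh x) + ln (1 - 1 / 2 * (1 / cosh
  x)\<^sup>2)\<close> the constant is invisible to \<open>u\<close>, and the last term is the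
  negative of a positive definite kernel.\<close>

lemma quad_form_ln_cosh_double:
  assumes "pd_kernel (\<lambda>i j. 1 / cosh (d i j))" "(\<Sum>i\<in>UNIV. u i) = 0"
  shows "quad_form u (\<lambda>i j. ln (cosh (2 * d i j))) \<le> 2 * quad_form u (\<lambda>i j. ln (cosh (d i j)))"
proof -
  have "ln (cosh (2 * x)) = ln 2 + 2 * ln (cosh x) - - ln (1 - 1 / 2 * (1 / cosh x)\<^sup>2)" for x :: real
  proof -
    have c: "cosh x \<ge> 1"
      by (rule cosh_real_ge_1)
    then have "cosh (2 * x) = 2 * (cosh x)\<^sup>2 * (1 - 1 / 2 * (1 / cosh x)\<^sup>2)"
      unfolding cosh_double_cosh by (simp add: field_simps)
    moreover have "1 - 1 / 2 * (1 / cosh x)\<^sup>2 > 0"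
      using inverse_cosh_power2_le_1[of x] by linarith
    ultimately show ?thesis
      using c by (simp add: ln_mult ln_realpow)
  qed
  then have "quad_form u (\<lambda>i j. ln (cosh (2 * d i j))) = 2 * quad_form u (\<lambda>i j. ln (cosh (d i j)))
      - quad_form u (\<lambda>i j. - ln (1 - 1 / 2 * (1 / cosh (d i j))\<^sup>2))"
    by (simp only: quad_form_add quad_form_diff quad_form_cmult quad_form_const[OF assms(2)])
  then show ?thesis
    using quad_form_nonneg[OF pd_kernel_inverse_cosh_double(2)[OF assms(1)], of u] by simp
qed

lemma ln_cosh_rescaled_tendsto:
  assumes "x \<ge> (0::real)"
  shows "(\<lambda>m. 1 / 2 ^ m * ln (cosh (2 ^ m * x))) \<longlonglongrightarrow> x"
proof (rule real_tendsto_sandwich)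
  have "y - ln 2 \<le> ln (cosh y) \<and> ln (cosh y) \<le> y" if "y \<ge> 0" for y :: real
  proof -
    have "ln (exp y / 2) \<le> ln (cosh y)"
      using cosh_real_pos[of y] by (intro ln_mono) (auto simp: cosh_def)
    moreover have "ln (cosh y) \<le> ln (exp y)"
      using that cosh_real_pos[of y] by (intro ln_mono) (auto simp: cosh_def)
    ultimately show ?thesis
      by (simp add: ln_div)
  qed
  from this[of "2 ^ m * x" for m] assms
  have "1 / 2 ^ m * (2 ^ m * x - ln 2) \<le> 1 / 2 ^ m * ln (cosh (2 ^ m * x))"
    "1 / 2 ^ m * ln (cosh (2 ^ m * x)) \<le> 1 / 2 ^ m * (2 ^ m * x)" for m
    by (intro mult_left_mono; simp)+
  then show "\<forall>\<^sub>F m in sequentially. x - ln 2 / 2 ^ m \<le> 1 / 2 ^ m * ln (cosh (2 ^ m * x))"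
    and "\<forall>\<^sub>F m in sequentially. 1 / 2 ^ m * ln (cosh (2 ^ m * x)) \<le> x"
    by (auto simp: right_diff_distrib)
  show "(\<lambda>m. x - ln 2 / 2 ^ m) \<longlonglongrightarrow> x"
    by real_asymp
qed simp

text \<open>The rescaled forms start at the right-hand side, never exceed it, and tend to the
  left-hand side. Strictness survives the limit because it will come from the fixed upper
  bound.\<close>

lemma quad_form_le_ln_cosh:
  assumes pd: "pd_kernel (\<lambda>i j. 1 / cosh (d i j))" and sum: "(\<Sum>i\<in>UNIV. u i) = 0"
    and d: "\<And>i j. d i j \<ge> 0"
  shows "quad_form u d \<le> quad_form u (\<lambda>i j. ln (cosh (d i j)))"
proof (rule LIMSEQ_le_const2)
  show "(\<lambda>m. quad_form u (\<lambda>i j. 1 / 2 ^ m * ln (cosh (2 ^ m * d i j)))) \<longlonglongrightarrow> quad_form u d"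
    by (intro tendsto_quad_form ln_cosh_rescaled_tendsto d)
  \<comment> \<open>Positive definiteness is carried through the induction because each doubling
    step requires it at the current scale.\<close>
  have "pd_kernel (\<lambda>i j. 1 / cosh (2 ^ m * d i j)) \<and>
      quad_form u (\<lambda>i j. ln (cosh (2 ^ m * d i j))) \<le> 2 ^ m * quad_form u (\<lambda>i j. ln (cosh (d i j)))" for m
  proof (induction m)
    case (Suc m)
    then show ?case
      using pd_kernel_inverse_cosh_double(1)[of "\<lambda>i j. 2 ^ m * d i j"]
        quad_form_ln_cosh_double[OF _ sum, of "\<lambda>i j. 2 ^ m * d i j"]
      by (simp add: mult.assoc)
  qed (simp add: pd)
  then show "\<exists>N. \<forall>m\<ge>N. quad_form u (\<lambda>i j. 1 / 2 ^ m * ln (cosh (2 ^ m * d i j)))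
      \<le> quad_form u (\<lambda>i j. ln (cosh (d i j)))"
    unfolding quad_form_cmult by (simp add: field_simps)
qed

lemma (in timelike_family) quad_form_arcosh_B_neg:
  assumes B: "\<And>i j. B i j \<ge> 1" and u: "(\<Sum>i\<in>UNIV. u i) = 0" "u i0 \<noteq> 0"
  shows "quad_form u (\<lambda>i j. arcosh (B i j)) < 0"
proof -
  have cosh: "cosh (arcosh (B i j)) = B i j" for i j
    using B by (simp add: cosh_arcosh_real)
  have "quad_form u (\<lambda>i j. arcosh (B i j)) \<le> quad_form u (\<lambda>i j. ln (B i j))"
    using quad_form_le_ln_cosh[of "\<lambda>i j. arcosh (B i j)" u] pd_kernel_inverse_B u(1) B
    by (simp add: cosh arcosh_nonneg_real)
  also have "\<dots> < 0"
    by (rule quad_form_ln_B_neg[OF u])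
  finally show ?thesis .
qed

section \<open>Hyperbolic distance\<close>

lemma quad_form_hyperbolic_dist_neg:
  fixes x :: "'i::finite \<Rightarrow> real \<times> 'e::euclidean_space"
  assumes x: "range x \<subseteq> hyperbolic_space" "inj x"
    and u: "(\<Sum>i\<in>UNIV. u i) = 0" "u i0 \<noteq> 0"
  shows "quad_form u (\<lambda>i j. hyperbolic_dist (x i) (x j)) < 0"
proof -
  define S p where "S = (\<lambda>i. fst (x i))" and "p = (\<lambda>i. snd (x i))"
  have pos: "S i > 0" and eq: "(S i)\<^sup>2 = 1 + (norm (p i))\<^sup>2" for i
    using subsetD[OF x(1) rangeI[of x i]]
    by (auto simp: hyperbolic_space_def S_def p_def power2_norm_eq_inner case_prod_beta algebra_simps)
  interpret timelike_family S p
  proof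
    show less: "norm (p i) < S i" for i
      by (rule power2_less_imp_less) (use eq[of i] pos[of i] in auto)
    \<comment> \<open>The norm of the projected point determines \<open>S i\<close>, hence
      projection is injective on the hyperboloid.\<close>
    have S: "1 - (norm (p i /\<^sub>R S i))\<^sup>2 = 1 / (S i)\<^sup>2" for i
    proof -
      have N: "(norm (p i))\<^sup>2 = (S i)\<^sup>2 - 1"
        using eq[of i] by simp
      show ?thesis
        using pos[of i] by (simp add: power_divide power_mult_distrib N field_simps)
    qed
    show "inj (\<lambda>i. p i /\<^sub>R S i)"
    proof (rule injI)
      fix i j assume *: "p i /\<^sub>R S i = p j /\<^sub>R S j"
      then have "(S i)\<^sup>2 = (S j)\<^sup>2"
        using S[of i] S[of j] by simp
      then have "S i = S j"
        using pos[of i] pos[of j] by simp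
      with * have "x i = x j"
        using pos[of j] by (simp add: prod_eq_iff S_def p_def)
      with \<open>inj x\<close> show "i = j"
        by (simp add: inj_def)
    qed
  qed
  have "B i j \<ge> 1" for i j
  proof -
    \<comment> \<open>After squaring, this is \<open>2 * a * b \<le> a\<^sup>2 + b\<^sup>2\<close>
      for the two norms.\<close>
    have "1 + norm (p i) * norm (p j) \<le> S i * S j"
    proof (rule power2_le_imp_le)
      show "(1 + norm (p i) * norm (p j))\<^sup>2 \<le> (S i * S j)\<^sup>2"
        using sum_squares_bound[of "norm (p i)" "norm (p j)"]
        by (simp add: power_mult_distrib eq) (simp add: algebra_simps power2_eq_square)
    qed (use pos[of i] pos[of j] in auto)
    then show ?thesis
      using norm_cauchy_schwarz[of "p i" "p j"] by (simp add: B_def)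
  qed
  then show ?thesis
    using quad_form_arcosh_B_neg[OF _ u] unfolding B_def by (simp add: hyperbolic_dist_def S_def p_def)
qed

section \<open>Euclidean distance\<close>

text \<open>
  \<open>s\<^sup>2 + (dist x y)\<^sup>2\<close> is the Minkowski product of the timelike vectors
  \<open>(norm x\<^sup>2 + (s\<^sup>2 + 1) / 2, norm x\<^sup>2 + (s\<^sup>2 - 1) / 2, sqrt 2 * x)\<close> and the same with \<open>y\<close>.
\<close>

lemma quad_form_ln_dist_neg:
  fixes x :: "'i::finite \<Rightarrow> 'e::euclidean_space"
  assumes "inj x" "s > 0" and u: "(\<Sum>i\<in>UNIV. u i) = 0" "u i0 \<noteq> 0"
  shows "quad_form u (\<lambda>i j. ln (1 + (dist (x i) (x j))\<^sup>2 / s\<^sup>2)) < 0"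
proof -
  define S p where "S = (\<lambda>i. (norm (x i))\<^sup>2 + (s\<^sup>2 + 1) / 2)"
    and "p = (\<lambda>i. ((norm (x i))\<^sup>2 + (s\<^sup>2 - 1) / 2, sqrt 2 *\<^sub>R x i))"
  have pos: "S i > 0" for i
    by (simp add: S_def add_nonneg_pos)
  interpret timelike_family S p
  proof
    show "norm (p i) < S i" for i
    proof (rule power2_less_imp_less)
      \<comment> \<open>The two sides differ by exactly \<open>s\<^sup>2\<close>.\<close>
      show "(norm (p i))\<^sup>2 < (S i)\<^sup>2"
        using \<open>s > 0\<close> by (simp add: p_def S_def norm_Pair power_mult_distrib)
          (simp add: power2_eq_square field_simps add_pos_nonneg)
    qed (use pos[of i] in simp)
    show "inj (\<lambda>i. p i /\<^sub>R S i)"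
    proof (rule injI)
      fix i j assume *: "p i /\<^sub>R S i = p j /\<^sub>R S j"
      \<comment> \<open>The first coordinate of \<open>p i\<close> is \<open>S i - 1\<close>, so the
        projected point determines \<open>S i\<close>.\<close>
      have "fst (p i /\<^sub>R S i) = 1 - 1 / S i" for i
        using pos[of i] by (simp add: p_def field_simps) (simp add: S_def field_simps)
      with * have "1 - 1 / S i = 1 - 1 / S j"
        by metis
      then have "S i = S j"
        by simp
      with * have "x i = x j"
        using pos[of j] by (simp add: p_def)
      with \<open>inj x\<close> show "i = j"
        by (simp add: inj_def)
    qed
  qed
  have "B i j = s\<^sup>2 + (dist (x i) (x j))\<^sup>2" for i j
  proof -
    have prod: "(a + (s\<^sup>2 + 1) / 2) * (b + (s\<^sup>2 + 1) / 2) - (a + (s\<^sup>2 - 1) / 2) * (b + (s\<^sup>2 - 1) / 2)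
        = a + b + s\<^sup>2" for a b :: real
      by (simp add: algebra_simps add_divide_distrib diff_divide_distrib)
    have "p i \<bullet> p j = ((norm (x i))\<^sup>2 + (s\<^sup>2 - 1) / 2) * ((norm (x j))\<^sup>2 + (s\<^sup>2 - 1) / 2)
        + 2 * (x i \<bullet> x j)"
      by (simp add: p_def mult.assoc[symmetric])
    then have "B i j = (norm (x i))\<^sup>2 + (norm (x j))\<^sup>2 + s\<^sup>2 - 2 * (x i \<bullet> x j)"
      using prod[of "(norm (x i))\<^sup>2" "(norm (x j))\<^sup>2"] unfolding B_def by (simp add: S_def)
    then show ?thesis
      by (simp add: dist_norm power2_norm_eq_inner inner_diff_left inner_diff_right inner_commute)
  qed
  then have "1 + (dist (x i) (x j))\<^sup>2 / s\<^sup>2 = B i j / s\<^sup>2" "B i j > 0" for i j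
    using \<open>s > 0\<close> by (simp_all add: field_simps add_pos_nonneg)
  then have "ln (1 + (dist (x i) (x j))\<^sup>2 / s\<^sup>2) = ln (B i j) - ln (s\<^sup>2)" for i j
    using \<open>s > 0\<close> less_imp_neq[of 0 "B i j"] by (simp add: ln_div)
  then have "quad_form u (\<lambda>i j. ln (1 + (dist (x i) (x j))\<^sup>2 / s\<^sup>2)) = quad_form u (\<lambda>i j. ln (B i j))"
    by (simp only: quad_form_diff quad_form_const[OF u(1)])
  then show ?thesis
    using quad_form_ln_B_neg[OF u] by simp
qed

text \<open>The junk value \<open>s / 0 = 0\<close> makes the formula correct for \<open>r = 0\<close> as well.\<close>

definition ln_primitive :: "real \<Rightarrow> real \<Rightarrow> real" where
  "ln_primitive r s = s * ln (1 + r\<^sup>2 / s\<^sup>2) + 2 * r * arctan (s / r)"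

lemma ln_primitive_deriv:
  assumes "r \<ge> 0" "s > 0"
  shows "(ln_primitive r has_real_derivative ln (1 + r\<^sup>2 / s\<^sup>2)) (at s)"
proof (cases "r = 0")
  case False
  have pos: "s\<^sup>2 + r\<^sup>2 > 0"
    using assms by (simp add: add_pos_nonneg)
  have "1 + r\<^sup>2 / s\<^sup>2 = (s\<^sup>2 + r\<^sup>2) / s\<^sup>2" "1 + (s / r)\<^sup>2 = (s\<^sup>2 + r\<^sup>2) / r\<^sup>2"
    using assms False by (simp_all add: field_simps)
  moreover have "((\<lambda>s. ln (1 + r\<^sup>2 / s\<^sup>2)) has_real_derivative
      (- (2 * s * r\<^sup>2) / (s\<^sup>2)\<^sup>2) / (1 + r\<^sup>2 / s\<^sup>2)) (at s)"
    "((\<lambda>s. arctan (s / r)) has_real_derivative (1 / r) / (1 + (s / r)\<^sup>2)) (at s)"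
    using assms False
    by (auto intro!: derivative_eq_intros simp: add_pos_nonneg power2_eq_square)
      (simp_all add: mult_ac inverse_eq_divide)
  ultimately have d: "((\<lambda>s. ln (1 + r\<^sup>2 / s\<^sup>2)) has_real_derivative - (2 * r\<^sup>2) / (s * (s\<^sup>2 + r\<^sup>2))) (at s)"
    "((\<lambda>s. arctan (s / r)) has_real_derivative r / (s\<^sup>2 + r\<^sup>2)) (at s)"
    using assms False by (simp_all add: power2_eq_square)
  \<comment> \<open>The term from differentiating the logarithm cancels the one from the arctangent,
    leaving only the logarithm itself.\<close>
  have "- (2 * r\<^sup>2) / (s * P) * s + 2 * r * (r / P) = 0" if "P > 0" for P
    using that assms by (simp add: field_simps power2_eq_square)
  note zero = this[OF pos]
  show ?thesis
    unfolding ln_primitive_def[abs_def]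
    by (rule DERIV_cong[OF DERIV_add[OF DERIV_mult[OF DERIV_ident d(1)] DERIV_cmult[OF d(2)]]])
      (use zero in linarith)
qed (simp add: ln_primitive_def[abs_def])

text \<open>At infinity the logarithmic term decays like \<open>r\<^sup>2 / s\<close>, and the
  arctangent contributes \<open>2 * r * (pi / 2)\<close>.\<close>

lemma ln_primitive_tendsto:
  assumes "r \<ge> 0"
  shows "(ln_primitive r \<longlongrightarrow> 0) (at_right 0)" "(ln_primitive r \<longlongrightarrow> pi * r) at_top"
proof -
  have "(ln_primitive r \<longlongrightarrow> 0) (at_right 0) \<and> (ln_primitive r \<longlongrightarrow> pi * r) at_top"
  proof (cases "r = 0")
    case False
    with assms have "r > 0" by simp
    then show ?thesis
      unfolding ln_primitive_def[abs_def] by (intro conjI; real_asymp)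
  qed (simp add: ln_primitive_def[abs_def])
  then show "(ln_primitive r \<longlongrightarrow> 0) (at_right 0)" "(ln_primitive r \<longlongrightarrow> pi * r) at_top"
    by auto
qed

text \<open>\<open>G\<close> decreases strictly on the positive axis from the limit 0 to
  \<open>pi\<close> times the form. The comparison \<open>G 2 < G 1\<close> keeps the inequality
  strict although both limits give only weak ones.\<close>

lemma quad_form_dist_neg:
  fixes x :: "'i::finite \<Rightarrow> 'e::euclidean_space"
  assumes "inj x" and u: "(\<Sum>i\<in>UNIV. u i) = 0" "u i0 \<noteq> 0"
  shows "quad_form u (\<lambda>i j. dist (x i) (x j)) < 0"
proof -
  define G where "G s = quad_form u (\<lambda>i j. ln_primitive (dist (x i) (x j)) s)" for s
  have "(G has_real_derivative quad_form u (\<lambda>i j. ln (1 + (dist (x i) (x j))\<^sup>2 / s\<^sup>2))) (at s)"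
    if "s > 0" for s
    unfolding G_def quad_form_def using that
    by (intro DERIV_sum DERIV_cmult ln_primitive_deriv) auto
  with quad_form_ln_dist_neg[OF assms(1) _ u]
  have neg: "\<exists>y. (G has_real_derivative y) (at s) \<and> y < 0" if "s > 0" for s
    using that by blast
  have dec: "G b < G a" if "0 < a" "a < b" for a b
    using \<open>0 < a\<close> by (intro DERIV_neg_imp_decreasing[OF \<open>a < b\<close>] neg) simp
  have "G 1 \<le> 0"
  proof (rule tendsto_lowerbound)
    show "(G \<longlongrightarrow> 0) (at_right 0)"
      using tendsto_quad_form[OF ln_primitive_tendsto(1), of "\<lambda>i j. dist (x i) (x j)" u]
      by (simp add: G_def[abs_def] quad_form_const[OF u(1)])
    show "\<forall>\<^sub>F s in at_right 0. G 1 \<le> G s"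
      by (rule eventually_at_rightI[of 0 1]) (auto intro: less_imp_le dec)
  qed simp
  moreover have "pi * quad_form u (\<lambda>i j. dist (x i) (x j)) \<le> G 2"
  proof (rule tendsto_upperbound)
    show "(G \<longlongrightarrow> pi * quad_form u (\<lambda>i j. dist (x i) (x j))) at_top"
      unfolding G_def quad_form_cmult[symmetric]
      by (intro tendsto_quad_form ln_primitive_tendsto) simp
    show "\<forall>\<^sub>F s in at_top. G s \<le> G 2"
      using eventually_gt_at_top[of 2] by eventually_elim (simp add: dec less_imp_le)
  qed simp
  ultimately have "pi * quad_form u (\<lambda>i j. dist (x i) (x j)) < 0"
    using dec[of 1 2] by simp
  then show ?thesis
    by (simp add: mult_less_0_iff)
qed

section \<open>Trees\<close>

text \<open>Moving the weight of the leaf \<open>v\<close> to its neighbour \<open>p\<close>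
  preserves the sum, and the old form at the moved weights exceeds the new form by
  \<open>2 * c * (u v)\<^sup>2\<close>.\<close>

lemma negative_type_insert:
  fixes \<delta> :: "'a \<Rightarrow> 'a \<Rightarrow> real"
  assumes fin: "finite S" and p: "p \<in> S" "v \<notin> S" and c: "c > 0"
    and \<delta>: "\<delta> p p = 0" "\<And>x y. x \<in> S \<Longrightarrow> y \<in> S \<Longrightarrow> \<delta> x y = \<delta> y x"
    and \<delta>': "\<And>x y. x \<in> S \<Longrightarrow> y \<in> S \<Longrightarrow> \<delta>' x y = \<delta> x y"
      "\<And>x. x \<in> S \<Longrightarrow> \<delta>' v x = c + \<delta> p x" "\<And>x. x \<in> S \<Longrightarrow> \<delta>' x v = c + \<delta> p x" "\<delta>' v v = 0"
    and neg: "\<And>u. (\<Sum>x\<in>S. u x) = 0 \<Longrightarrow> \<exists>x\<in>S. u x \<noteq> 0 \<Longrightarrow> (\<Sum>x\<in>S. \<Sum>y\<in>S. u x * u y * \<delta> x y) < 0"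
    and u: "(\<Sum>x\<in>insert v S. u x) = 0" "\<exists>x\<in>insert v S. u x \<noteq> 0"
  shows "(\<Sum>x\<in>insert v S. \<Sum>y\<in>insert v S. u x * u y * \<delta>' x y) < 0"
proof -
  define w where "w x = u x + (if x = p then u v else 0)" for x
  have sum_u: "(\<Sum>x\<in>S. u x) = - u v"
    using u fin p by simp
  define L where "L = (\<Sum>x\<in>S. u x * \<delta> p x)"
  have sum_if: "(\<Sum>x\<in>S. (if x = p then u v else 0) * g x) = u v * g p" for g
    using fin p by (simp add: if_distrib[of "\<lambda>t. t * _"] cong: if_cong)
  have sum_w: "(\<Sum>x\<in>S. w x * g x) = (\<Sum>x\<in>S. u x * g x) + u v * g p" for g
    by (simp add: w_def distrib_right sum.distrib sum_if)
  have "(\<Sum>x\<in>S. \<Sum>y\<in>S. w x * w y * \<delta> x y) = (\<Sum>x\<in>S. w x * (\<Sum>y\<in>S. w y * \<delta> x y))"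
    by (simp add: sum_distrib_left mult.assoc)
  also have "\<dots> = (\<Sum>x\<in>S. u x * (\<Sum>y\<in>S. u y * \<delta> x y)) + (\<Sum>x\<in>S. u x * (u v * \<delta> x p)) + u v * L"
    by (simp add: sum_w distrib_left sum.distrib L_def \<delta>(1))
  also have "(\<Sum>x\<in>S. u x * (u v * \<delta> x p)) = u v * L"
    using p \<delta>(2) by (simp add: L_def sum_distrib_left mult_ac)
  finally have W: "(\<Sum>x\<in>S. \<Sum>y\<in>S. w x * w y * \<delta> x y)
      = (\<Sum>x\<in>S. u x * (\<Sum>y\<in>S. u y * \<delta> x y)) + 2 * u v * L"
    by simp
  have cross: "(\<Sum>x\<in>S. u x * (c + \<delta> p x)) = L - c * u v"
    by (simp add: distrib_left sum.distrib L_def sum_u flip: sum_distrib_right)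
  have "(\<Sum>x\<in>insert v S. \<Sum>y\<in>insert v S. u x * u y * \<delta>' x y) =
      (\<Sum>x\<in>S. u x * (\<Sum>y\<in>S. u y * \<delta> x y)) + 2 * u v * (\<Sum>x\<in>S. u x * (c + \<delta> p x))"
    using fin p by (simp add: \<delta>' sum.distrib sum_distrib_left mult_ac)
  also have "\<dots> = (\<Sum>x\<in>S. \<Sum>y\<in>S. w x * w y * \<delta> x y) - 2 * c * (u v)\<^sup>2"
    unfolding W cross by (simp add: algebra_simps power2_eq_square)
  also have "\<dots> < 0"
  \<comment> \<open>Either the form at \<open>w\<close> is strictly negative, or \<open>w\<close>
    vanishes on \<open>S\<close>; then \<open>u v\<close> is nonzero and the square term gives
    strictness.\<close>
  proof (cases "\<exists>x\<in>S. w x \<noteq> 0")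
    case True
    moreover have "(\<Sum>x\<in>S. w x) = 0"
      using sum_w[of "\<lambda>_. 1"] sum_u by simp
    ultimately have "(\<Sum>x\<in>S. \<Sum>y\<in>S. w x * w y * \<delta> x y) < 0"
      by (rule neg[rotated])
    moreover have "0 \<le> 2 * c * (u v)\<^sup>2"
      using c by simp
    ultimately show ?thesis
      by linarith
  next
    case False
    have "u v \<noteq> 0"
    proof
      assume "u v = 0"
      moreover from this have "w = u"
        by (simp add: w_def fun_eq_iff)
      ultimately have "\<forall>x\<in>insert v S. u x = 0"
        using False by simp
      with u(2) show False by blast
    qed
    with c have "0 < 2 * c * (u v)\<^sup>2"
      by simp
    with False show ?thesis
      by simp
  qed
  finally show ?thesis .
qed

section \<open>Arcs and cycles of a weighted tree\<close>

locale weighted_tree = graph +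
  fixes l :: "'b \<Rightarrow> real"
  assumes tree: "finite_tree G" and lengths: "edge_lengths G l"
begin

lemma reverse_arc:
  assumes "e \<in> arcs G"
  obtains e' where "e' \<in> arcs G" "tail G e' = head G e" "head G e' = tail G e" "l e' = l e"
proof -
  have "(head G e, tail G e) \<in> arcs_ends G"
    using sym_arcs in_arcs_imp_in_arcs_ends[OF assms] by (auto simp: symmetric_def dest: symD)
  then obtain e' where "e' \<in> arcs G" "(head G e, tail G e) = arc_to_ends G e'"
    unfolding arcs_ends_def by (rule imageE)
  then have e': "e' \<in> arcs G" "tail G e' = head G e" "head G e' = tail G e"
    by (simp_all add: arc_to_ends_def)
  have "\<forall>f\<in>arcs G. \<forall>f'\<in>arcs G. tail G f = head G f' \<and> head G f = tail G f' \<longrightarrow> l f = l f'"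
    using lengths unfolding edge_lengths_def by blast
  then have "l e' = l e"
    using assms e' by blast
  with e' show ?thesis
    by (rule that)
qed

lemma reachable: "u \<in> verts G \<Longrightarrow> v \<in> verts G \<Longrightarrow> u \<rightarrow>\<^sup>* v"
  using symmetric_connected_imp_strongly_connected[OF sym_arcs] tree
  by (auto simp: finite_tree_def strongly_connected_def)

definition stays_in :: "'a set \<Rightarrow> 'b list \<Rightarrow> bool" where
  "stays_in S p \<longleftrightarrow> (\<forall>e\<in>set p. tail G e \<in> S \<and> head G e \<in> S)"

text \<open>If \<open>q\<close> and \<open>p\<close> differed, a path from \<open>q\<close> to
  \<open>p\<close> inside \<open>S\<close> would be nonempty and avoid \<open>v\<close>; closing it
  up through \<open>v\<close> would give a cycle of length at least 3.\<close>

lemma unique_neighbour: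
  assumes walk: "awalk q w p" "stays_in S w"
    and arcs: "e \<in> arcs G" "f \<in> arcs G" "tail G e = p" "head G e = v" "tail G f = v" "head G f = q"
    and v: "v \<notin> S" and q: "q \<in> S"
  shows "q = p"
proof (rule ccontr)
  assume "q \<noteq> p"
  define a where "a = awalk_to_apath w"
  have a: "apath q a p" "stays_in S a"
    using apath_awalk_to_apath[OF walk(1)] awalk_to_apath_subset[OF walk(1)] walk(2)
    by (auto simp: a_def stays_in_def)
  then have "a \<noteq> []"
    using \<open>q \<noteq> p\<close> by (auto simp: apath_Nil_iff)
  have aw: "awalk q a p" and dist: "distinct (awalk_verts q a)"
    using a(1) by (auto simp: apath_def)
  have "set (awalk_verts q a) \<subseteq> S"
    using set_awalk_verts_not_Nil[OF aw \<open>a \<noteq> []\<close>] a(2) by (auto simp: stays_in_def)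
  have aw': "awalk q (a @ [e]) v"
    using arc_implies_awalk[OF arcs(1)] unfolding arcs(3,4) by (rule awalk_appendI[OF aw])
  have "awalk_verts q (a @ [e]) = awalk_verts q a @ [v]"
    using awalk_verts_append[OF aw'] arcs by simp
  then have "distinct (tl (awalk_verts v (f # a @ [e])))"
    using dist \<open>set (awalk_verts q a) \<subseteq> S\<close> v arcs by auto
  moreover have "awalk v (f # a @ [e]) v"
    using aw' arcs by (simp add: awalk_Cons_iff del: awalk_append_iff)
  ultimately have "cycle (f # a @ [e])"
    unfolding cycle_def by blast
  moreover have "length (f # a @ [e]) \<ge> 3"
    using \<open>a \<noteq> []\<close> by (cases a) auto
  ultimately show False
    using tree by (auto simp: finite_tree_def)
qed

lemma leaving_arc:
  assumes "S \<subseteq> verts G" "S \<noteq> {}" "S \<noteq> verts G"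
  obtains e where "e \<in> arcs G" "tail G e \<in> S" "head G e \<in> verts G - S"
proof -
  obtain r w where rw: "r \<in> S" "w \<in> verts G" "w \<notin> S"
    using assms by blast
  have "\<exists>e\<in>arcs G. tail G e \<in> S \<and> head G e \<notin> S"
  proof (rule ccontr)
    assume no: "\<not> ?thesis"
    have "r \<rightarrow>\<^sup>* w"
      using rw assms by (intro reachable) auto
    then have "w \<in> S"
    proof (induction rule: reachable_induct)
      case (step x y)
      then show ?case
        using no by (auto simp: arcs_ends_def arc_to_ends_def)
    qed (rule rw)
    with rw show False by simp
  qed
  then show ?thesis
    using that by auto
qed

section \<open>The path metric of a tree\<close>

text \<open>
  The tree is built up leaf by leaf, together with its path metric \<open>\<delta>\<close>. Uniqueness of paths is not
  needed: the triangle inequality and the values on arcs make \<open>\<delta>\<close> a lower bound for the length of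
  every walk, and some walk stays_in \<open>S\<close> attains it.
\<close>

definition tree_metric :: "'a set \<Rightarrow> ('a \<Rightarrow> 'a \<Rightarrow> real) \<Rightarrow> bool" where
  "tree_metric S \<delta> \<longleftrightarrow>
    (\<forall>x\<in>S. \<delta> x x = 0) \<and>
    (\<forall>x\<in>S. \<forall>y\<in>S. \<delta> x y = \<delta> y x) \<and>
    (\<forall>x\<in>S. \<forall>y\<in>S. \<forall>z\<in>S. \<delta> x z \<le> \<delta> x y + \<delta> y z) \<and>
    (\<forall>e\<in>arcs G. tail G e \<in> S \<and> head G e \<in> S \<longrightarrow> \<delta> (tail G e) (head G e) \<le> l e) \<and>
    (\<forall>x\<in>S. \<forall>y\<in>S. \<exists>w. awalk x w y \<and> stays_in S w \<and> awalk_cost l w = \<delta> x y) \<and>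
    (\<forall>u. (\<Sum>x\<in>S. u x) = 0 \<and> (\<exists>x\<in>S. u x \<noteq> 0) \<longrightarrow> (\<Sum>x\<in>S. \<Sum>y\<in>S. u x * u y * \<delta> x y) < 0)"

lemma tree_metric_insert:
  assumes \<delta>: "tree_metric S \<delta>" and S: "S \<subseteq> verts G"
    and e: "e \<in> arcs G" "tail G e = p" "head G e = v" and p: "p \<in> S" "v \<in> verts G" "v \<notin> S"
  shows "\<exists>\<delta>'. tree_metric (insert v S) \<delta>'"
proof -
  obtain e' where e': "e' \<in> arcs G" "tail G e' = v" "head G e' = p" "l e' = l e"
    using reverse_arc[OF e(1)] e by metis
  have pos: "l e > 0"
    using lengths e unfolding edge_lengths_def by blast
  have zero: "\<delta> x x = 0" if "x \<in> S" for x
    using \<delta> that unfolding tree_metric_def by blast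
  have sym: "\<delta> x y = \<delta> y x" if "x \<in> S" "y \<in> S" for x y
    using \<delta> that unfolding tree_metric_def by blast
  have tri: "\<delta> x z \<le> \<delta> x y + \<delta> y z" if "x \<in> S" "y \<in> S" "z \<in> S" for x y z
    using \<delta> that unfolding tree_metric_def by blast
  have arc: "\<delta> (tail G f) (head G f) \<le> l f" if "f \<in> arcs G" "tail G f \<in> S" "head G f \<in> S" for f
    using \<delta> that unfolding tree_metric_def by blast
  have walk: "\<exists>w. awalk x w y \<and> stays_in S w \<and> awalk_cost l w = \<delta> x y" if "x \<in> S" "y \<in> S" for x y
    using \<delta> that unfolding tree_metric_def by blast
  have nonneg: "\<delta> x y \<ge> 0" if "x \<in> S" "y \<in> S" for x y
    using tri[of x y x] zero[of x] sym[of x y] that by simp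
  \<comment> \<open>Hence \<open>e\<close> and \<open>e'\<close> are the only arcs between
    \<open>v\<close> and \<open>S\<close>, so the new metric has to be compared with arc lengths on
    these two only.\<close>
  have nb: "q = p" if "f \<in> arcs G" "tail G f = v" "head G f = q" "q \<in> S" for f q
    using walk[OF \<open>q \<in> S\<close> p(1)] unique_neighbour e that p by blast
  define \<delta>' where "\<delta>' x y = (if x = v then if y = v then 0 else l e + \<delta> p y
      else if y = v then l e + \<delta> p x else \<delta> x y)" for x y
  have ne: "x \<noteq> v" if "x \<in> S" for x
    using that p by auto
  have tri': "\<delta>' x z \<le> \<delta>' x y + \<delta>' y z" if "x \<in> insert v S" "y \<in> insert v S" "z \<in> insert v S" for x y z
    using that tri[of x y z] tri[of p x z] tri[of p y z] tri[of x p z] tri[of x y p] pos p sym[of x p]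
      sym[of y p] sym[of x y] nonneg[of p x] nonneg[of p y] nonneg[of p z]
    by (auto simp: \<delta>'_def)
  have arc': "\<delta>' (tail G f) (head G f) \<le> l f"
    if f: "f \<in> arcs G" "tail G f \<in> insert v S" "head G f \<in> insert v S" for f
  proof -
    obtain f' where f': "f' \<in> arcs G" "tail G f' = head G f" "head G f' = tail G f" "l f' = l f"
      using reverse_arc[OF f(1)] by metis
    consider "tail G f = v" "head G f \<in> S" | "tail G f \<in> S" "head G f = v" |
      "tail G f \<in> S" "head G f \<in> S"
      using f no_loops[of f] by fastforce
    then show ?thesis
    proof cases
      case 1
      then have "head G f = p"
        using nb f by blast
      with 1 have "f = e'"
        using f e' by (intro no_multi_arcs) (auto simp: arc_to_ends_def)
      with 1 \<open>head G f = p\<close> show ?thesis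
        using e' p zero[of p] ne[of p] by (simp add: \<delta>'_def)
    next
      case 2
      then have "tail G f = p"
        using nb[of f'] f' by simp
      with 2 have "f = e"
        using f e by (intro no_multi_arcs) (auto simp: arc_to_ends_def)
      with 2 \<open>tail G f = p\<close> show ?thesis
        using e p zero[of p] ne[of p] by (simp add: \<delta>'_def)
    next
      case 3
      then show ?thesis
        using arc[of f] f ne by (simp add: \<delta>'_def)
    qed
  qed
  have walk': "\<exists>w. awalk x w y \<and> stays_in (insert v S) w \<and> awalk_cost l w = \<delta>' x y"
    if xy: "x \<in> insert v S" "y \<in> insert v S" for x y
  proof -
    consider "x = v" "y = v" | "x = v" "y \<in> S" | "x \<in> S" "y = v" | "x \<in> S" "y \<in> S"
      using xy by blast
    then show ?thesis
    proof cases
      case 1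
      then show ?thesis
        using p by (intro exI[of _ "[]"]) (simp add: stays_in_def \<delta>'_def awalk_Nil_iff)
    next
      case 2
      obtain w where "awalk p w y" "stays_in S w" "awalk_cost l w = \<delta> p y"
        using walk[OF p(1) 2(2)] by blast
      with 2 show ?thesis
        using e' p ne[of y] by (intro exI[of _ "e' # w"]) (auto simp: stays_in_def \<delta>'_def awalk_Cons_iff)
    next
      case 3
      obtain w where w: "awalk x w p" "stays_in S w" "awalk_cost l w = \<delta> x p"
        using walk[OF 3(1) p(1)] by blast
      have "awalk x (w @ [e]) y"
        using arc_implies_awalk[OF e(1)] unfolding e(2,3) 3(2) by (rule awalk_appendI[OF w(1)])
      with 3 w show ?thesis
        using e p ne[of x] sym[of x p] by (intro exI[of _ "w @ [e]"]) (auto simp: stays_in_def \<delta>'_def)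
    next
      case 4
      then show ?thesis
        using walk[OF 4] ne by (fastforce simp: stays_in_def \<delta>'_def)
    qed
  qed
  have neg': "(\<Sum>x\<in>insert v S. \<Sum>y\<in>insert v S. u x * u y * \<delta>' x y) < 0"
    if u: "(\<Sum>x\<in>insert v S. u x) = 0" "\<exists>x\<in>insert v S. u x \<noteq> 0" for u
  proof (rule negative_type_insert[where \<delta> = \<delta> and p = p and c = "l e"])
    show "finite S"
      using S finite_verts finite_subset by blast
    show "(\<Sum>x\<in>S. \<Sum>y\<in>S. u x * u y * \<delta> x y) < 0" if "(\<Sum>x\<in>S. u x) = 0" "\<exists>x\<in>S. u x \<noteq> 0" for u
      using \<delta> that unfolding tree_metric_def by blast
  qed (use u p pos zero sym ne in \<open>auto simp: \<delta>'_def\<close>)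
  have "tree_metric (insert v S) \<delta>'"
    unfolding tree_metric_def
  proof (intro conjI ballI allI impI)
    show "\<delta>' x x = 0" if "x \<in> insert v S" for x
      using that zero[of x] by (auto simp: \<delta>'_def)
    show "\<delta>' x y = \<delta>' y x" if "x \<in> insert v S" "y \<in> insert v S" for x y
      using that sym[of x y] by (auto simp: \<delta>'_def)
  qed (use tri' arc' walk' neg' in auto)
  then show ?thesis
    by blast
qed

text \<open>Starting from one vertex and always following an arc that leaves \<open>S\<close>, the
  construction exhausts the finite vertex set.\<close>

lemma tree_metric_exists: "\<exists>\<delta>. tree_metric (verts G) \<delta>"
proof -
  have "\<exists>S \<delta>. S \<subseteq> verts G \<and> card S = Suc n \<and> tree_metric S \<delta>" if "Suc n \<le> card (verts G)" for n
    using that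
  proof (induction n)
    case 0
    then obtain r where "r \<in> verts G"
      by (metis card.empty not_less_eq_eq zero_le ex_in_conv)
    moreover have "tree_metric {r} (\<lambda>_ _. 0)"
    proof -
      have "0 < l e" if "e \<in> arcs G" for e
        using that lengths unfolding edge_lengths_def by blast
      then show ?thesis
        using \<open>r \<in> verts G\<close> by (auto simp: tree_metric_def stays_in_def awalk_Nil_iff
          intro!: exI[of _ "[]"] less_imp_le)
    qed
    ultimately show ?case
      by (intro exI[of _ "{r}"]) auto
  next
    case (Suc n)
    then obtain S \<delta> where S: "S \<subseteq> verts G" "card S = Suc n" "tree_metric S \<delta>"
      by auto
    with Suc.prems obtain e where "e \<in> arcs G" "tail G e \<in> S" "head G e \<in> verts G - S"
      by (metis leaving_arc card.empty nat.distinct(1) not_less_eq_eq order_refl)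
    with S obtain \<delta>' where "tree_metric (insert (head G e) S) \<delta>'"
      using tree_metric_insert[OF S(3,1), of e "tail G e" "head G e"] by auto
    moreover have "card (insert (head G e) S) = Suc (Suc n)"
      using S \<open>head G e \<in> verts G - S\<close> finite_subset[OF S(1) finite_verts] by simp
    ultimately show ?case
      using S \<open>head G e \<in> verts G - S\<close> by (intro exI[of _ "insert (head G e) S"]) auto
  qed
  moreover have "card (verts G) > 0"
    using tree by (auto simp: finite_tree_def connected_conv card_gt_0_iff)
  ultimately obtain S \<delta> where "S \<subseteq> verts G" "card S = card (verts G)" "tree_metric S \<delta>"
    by (metis Suc_pred order_refl)
  then show ?thesis
    using card_subset_eq[OF finite_verts] by blast
qed

lemma path_dist_eq:
  assumes \<delta>: "tree_metric (verts G) \<delta>" and uv: "u \<in> verts G" "v \<in> verts G"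
  shows "path_dist G l u v = \<delta> u v"
proof -
  \<comment> \<open>The triangle inequality splits off the first arc, whose length bounds
    \<open>\<delta>\<close> between its ends.\<close>
  have lower: "\<delta> u v \<le> awalk_cost l w" if "awalk u w v" for u w
    using that
  proof (induction w arbitrary: u)
    case Nil
    then show ?case
      using \<delta> by (auto simp: tree_metric_def awalk_Nil_iff)
  next
    case (Cons e w)
    then have e: "e \<in> arcs G" "u = tail G e" "awalk (head G e) w v"
      by (auto simp: awalk_Cons_iff)
    then have "v \<in> verts G"
      using awalk_last_in_verts by blast
    then have "\<delta> u v \<le> \<delta> u (head G e) + \<delta> (head G e) v" "\<delta> u (head G e) \<le> l e"
      using \<delta> e tail_in_verts[OF e(1)] head_in_verts[OF e(1)] unfolding tree_metric_def by blast+
    then show ?case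
      using Cons.IH[OF e(3)] by simp
  qed
  obtain w where w: "awalk u w v" "awalk_cost l w = \<delta> u v"
    using \<delta> uv unfolding tree_metric_def by blast
  have "\<mu> l u v = ereal (\<delta> u v)"
    unfolding \<mu>_def
  proof (rule antisym)
    show "(INF p\<in>{p. awalk u p v}. ereal (awalk_cost l p)) \<le> ereal (\<delta> u v)"
      using w by (intro INF_lower2[of w]) auto
    show "ereal (\<delta> u v) \<le> (INF p\<in>{p. awalk u p v}. ereal (awalk_cost l p))"
      using lower by (intro INF_greatest) auto
  qed
  then show ?thesis
    by (simp add: path_dist_def)
qed

lemma path_dist_negative_type:
  shows "x \<in> verts G \<Longrightarrow> path_dist G l x x = 0"
    and "x \<in> verts G \<Longrightarrow> y \<in> verts G \<Longrightarrow> path_dist G l x y = path_dist G l y x"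
    and "(\<Sum>x\<in>verts G. u x) = 0 \<Longrightarrow> \<exists>x\<in>verts G. u x \<noteq> 0 \<Longrightarrow>
      (\<Sum>x\<in>verts G. \<Sum>y\<in>verts G. u x * u y * path_dist G l x y) < 0"
proof -
  obtain \<delta> where \<delta>: "tree_metric (verts G) \<delta>"
    using tree_metric_exists by blast
  note eq = path_dist_eq[OF \<delta>]
  show "x \<in> verts G \<Longrightarrow> path_dist G l x x = 0"
    and "x \<in> verts G \<Longrightarrow> y \<in> verts G \<Longrightarrow> path_dist G l x y = path_dist G l y x"
    using \<delta> by (simp_all add: eq tree_metric_def)
  show "(\<Sum>x\<in>verts G. \<Sum>y\<in>verts G. u x * u y * path_dist G l x y) < 0"
    if "(\<Sum>x\<in>verts G. u x) = 0" "\<exists>x\<in>verts G. u x \<noteq> 0"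
  proof -
    have "(\<Sum>x\<in>verts G. \<Sum>y\<in>verts G. u x * u y * path_dist G l x y) =
        (\<Sum>x\<in>verts G. \<Sum>y\<in>verts G. u x * u y * \<delta> x y)"
      by (simp add: eq)
    with that \<delta> show ?thesis
      unfolding tree_metric_def by simp
  qed
qed

end

section \<open>Microscopic weightings of Euclidean and hyperbolic spaces and of trees\<close>

lemma strictly_negative_typeI:
  fixes x :: "'n::finite \<Rightarrow> 'a"
  assumes "\<And>u i. (\<Sum>i\<in>UNIV. u i) = 0 \<Longrightarrow> u i \<noteq> 0 \<Longrightarrow> quad_form u (\<lambda>i j. d (x i) (x j)) < 0"
  shows "strictly_negative_type d x"
  unfolding strictly_negative_type_def
proof (intro allI impI)
  fix u :: "real^'n" assume u: "u \<noteq> 0 \<and> 1 \<bullet> u = 0"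
  then obtain i where "u $ i \<noteq> 0"
    by (auto simp: vec_eq_iff)
  have "u \<bullet> (distance_matrix d x *v u) = quad_form (\<lambda>i. u $ i) (\<lambda>i j. d (x i) (x j))"
    by (simp add: quad_form_def inner_vec_def matrix_vector_mult_def distance_matrix_def
        sum_distrib_left mult_ac)
  then show "u \<bullet> (distance_matrix d x *v u) < 0"
    using assms[of "\<lambda>i. u $ i" i] u \<open>u $ i \<noteq> 0\<close> by (simp add: one_inner_vec)
qed

lemma negative_type_metric_space:
  assumes "Metric_space X d" "bij_betw x UNIV X" "strictly_negative_type d x"
  shows "strictly_negative_type_matrix d x"
proof -
  interpret Metric_space X d by fact
  have "x i \<in> X" for i
    using assms(2) by (auto simp: bij_betw_def)
  then show ?thesis
    using assms(3) by unfold_locales (auto simp: commute)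
qed

lemma negative_type_euclidean:
  fixes x :: "'n::finite \<Rightarrow> 'e::euclidean_space"
  assumes "inj x"
  shows "strictly_negative_type_matrix dist x"
proof
  show "strictly_negative_type dist x"
    by (rule strictly_negative_typeI) (rule quad_form_dist_neg[OF assms])
qed (auto simp: dist_commute)

lemma negative_type_hyperbolic:
  fixes x :: "'n::finite \<Rightarrow> real \<times> 'h::euclidean_space"
  assumes "range x \<subseteq> hyperbolic_space" "inj x"
  shows "strictly_negative_type_matrix hyperbolic_dist x"
proof
  show "hyperbolic_dist (x i) (x j) = hyperbolic_dist (x j) (x i)" for i j
    by (simp add: hyperbolic_dist_def inner_commute mult.commute)
  show "hyperbolic_dist (x i) (x i) = 0" for i
    using subsetD[OF assms(1) rangeI[of x i]]
    by (auto simp: hyperbolic_space_def hyperbolic_dist_def case_prod_beta power2_eq_square)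
  show "strictly_negative_type hyperbolic_dist x"
    by (rule strictly_negative_typeI) (rule quad_form_hyperbolic_dist_neg[OF assms])
qed

lemma negative_type_tree:
  assumes "finite_tree T" "edge_lengths T l" and x: "bij_betw x (UNIV :: 'n::finite set) (verts T)"
  shows "strictly_negative_type_matrix (path_dist T l) x"
proof -
  interpret graph T
    using assms(1) by (simp add: finite_tree_def)
  interpret weighted_tree T l
    by unfold_locales (rule assms)+
  have mem: "x i \<in> verts T" for i
    using x by (auto simp: bij_betw_def)
  have "quad_form u (\<lambda>i j. path_dist T l (x i) (x j)) < 0"
    if u: "(\<Sum>i\<in>UNIV. u i) = 0" "u i \<noteq> 0" for u i
  proof -
    \<comment> \<open>Weights on indices are transported to vertices, where the tree result is
      stated.\<close>
    define w where "w = u \<circ> inv x"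
    have w: "w (x i) = u i" for i
      using x by (simp add: w_def bij_betw_def)
    have reindex: "(\<Sum>a\<in>verts T. f a) = (\<Sum>i\<in>UNIV. f (x i))" for f :: "_ \<Rightarrow> real"
      by (rule sum.reindex_bij_betw[OF x, symmetric])
    have "(\<Sum>a\<in>verts T. \<Sum>b\<in>verts T. w a * w b * path_dist T l a b) < 0"
    proof (rule path_dist_negative_type(3))
      show "(\<Sum>a\<in>verts T. w a) = 0"
        using u(1) by (simp add: reindex w)
      show "\<exists>a\<in>verts T. w a \<noteq> 0"
        using u(2) mem[of i] by (intro bexI[of _ "x i"]) (simp_all add: w)
    qed
    then show ?thesis
      by (simp add: reindex w quad_form_def)
  qed
  then have "strictly_negative_type (path_dist T l) x"
    by (rule strictly_negative_typeI)
  then show ?thesis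
    using path_dist_negative_type(1,2) mem by unfold_locales blast+
qed

theorem theorem4p11:
  shows
    "(\<forall>(X :: 'a set) (d :: 'a \<Rightarrow> 'a \<Rightarrow> real) (x :: 'n::finite \<Rightarrow> 'a).
        Metric_space X d \<and> bij_betw x UNIV X \<and> strictly_negative_type d x \<longrightarrow>
        admits_microscopic_weighting d x \<and>
        one_point_property d x \<and>
        (card X \<ge> 2 \<longrightarrow>
           invertible (distance_matrix d x) \<and>
           con (distance_matrix d x) \<noteq> \<infinity> \<and>
           is_microscopic_weighting d x
             (real_of_ereal (con (distance_matrix d x)) *\<^sub>R
                (matrix_inv (distance_matrix d x) *v 1)))) \<and>
     (\<forall>(X :: 'e::euclidean_space set) (x :: 'n \<Rightarrow> 'e).
        bij_betw x UNIV X \<longrightarrow>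
        admits_microscopic_weighting dist x \<and>
        one_point_property dist x \<and>
        (card X \<ge> 2 \<longrightarrow>
           invertible (distance_matrix dist x) \<and>
           con (distance_matrix dist x) \<noteq> \<infinity> \<and>
           is_microscopic_weighting dist x
             (real_of_ereal (con (distance_matrix dist x)) *\<^sub>R
                (matrix_inv (distance_matrix dist x) *v 1)))) \<and>
     (\<forall>(X :: (real \<times> 'h::euclidean_space) set) (x :: 'n \<Rightarrow> real \<times> 'h).
        X \<subseteq> hyperbolic_space \<and> bij_betw x UNIV X \<longrightarrow>
        admits_microscopic_weighting hyperbolic_dist x \<and>
        one_point_property hyperbolic_dist x \<and>
        (card X \<ge> 2 \<longrightarrow>
           invertible (distance_matrix hyperbolic_dist x) \<and>
           con (distance_matrix hyperbolic_dist x) \<noteq> \<infinity> \<and>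
           is_microscopic_weighting hyperbolic_dist x
             (real_of_ereal (con (distance_matrix hyperbolic_dist x)) *\<^sub>R
                (matrix_inv (distance_matrix hyperbolic_dist x) *v 1)))) \<and>
     (\<forall>(T :: ('v, 'b) pre_digraph) (l :: 'b \<Rightarrow> real) (x :: 'n \<Rightarrow> 'v).
        finite_tree T \<and> edge_lengths T l \<and> bij_betw x UNIV (verts T) \<longrightarrow>
        admits_microscopic_weighting (path_dist T l) x \<and>
        one_point_property (path_dist T l) x \<and>
        (card (verts T) \<ge> 2 \<longrightarrow>
           invertible (distance_matrix (path_dist T l) x) \<and>
           con (distance_matrix (path_dist T l) x) \<noteq> \<infinity> \<and>
           is_microscopic_weighting (path_dist T l) x
             (real_of_ereal (con (distance_matrix (path_dist T l) x)) *\<^sub>R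
                (matrix_inv (distance_matrix (path_dist T l) x) *v 1))))"
  \<comment> \<open>All four parts are instances of the locale result; the bijection turns the
    cardinality of the space into that of the index type.\<close>
  apply (intro conjI allI)
  subgoal for X d x
    using strictly_negative_type_matrix.microscopic_weighting_and_one_point_property[of d x]
      negative_type_metric_space[of X d x] bij_betw_same_card[of x UNIV X] by (metis (no_types, lifting))
  subgoal for X x
    using strictly_negative_type_matrix.microscopic_weighting_and_one_point_property[of dist x]
      negative_type_euclidean[of x] bij_betw_same_card[of x UNIV X] unfolding bij_betw_def by metis
  subgoal for X x
    using strictly_negative_type_matrix.microscopic_weighting_and_one_point_property[of hyperbolic_dist x]
      negative_type_hyperbolic[of x] bij_betw_same_card[of x UNIV X] unfolding bij_betw_def by metis
  subgoal for T l x
    using strictly_negative_type_matrix.microscopic_weighting_and_one_point_property[of "path_dist T l" x]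
      negative_type_tree[of T l x] bij_betw_same_card[of x UNIV "verts T"] by metis
  done

end
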